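(* Let $X$ be an infinite-dimensional complex Banach space and let $T\in L(X)$. Then the $g_z$-Kato spectrum $$\sigma_{g_zK}(T)=\{\lambda\in\mathbb{C}: T-\lambda I \text{ is not a } g_z\text{-Kato operator}\}$$ is a compact subset of $\mathbb{C}$.
   Context: $L(X)$ is the algebra of bounded linear operators on $X$. The operator notions below are also applied to restrictions of operators to closed invariant subspaces (possibly $\{0\}$). For an operator $T$, $\mathcal{N}(T)$ and $\mathcal{R}(T)$ are its kernel and range, $\alpha(T)=\dim\mathcal{N}(T)$, and $\sigma(T)$ is its spectrum; for a $T$-invariant subspace $M$, $T_M$ is the restriction of $T$ to $M$, and $T_{[n]}=T_{\mathcal{R}(T^n)}$ for $n\in\mathbb{N}$. $(M,N)\in\mathrm{Red}(T)$ means that $M,N$ are closed $T$-invariant subspaces with $X=M\oplus N$. $\mathrm{acc}\,A$ is the set of accumulation points of $A\subset\mathbb{C}$. The degree of stable iteration of $T$ is $\mathrm{dis}(T)=\inf\{m\in\mathbb{N}:\alpha(T_{[m]})=\alpha(T_{[r]})\ \text{for all } r\in\mathbb{N},\ r\ge m\}$, with $\inf\emptyset=\infty$. $T$ is semi-regular if $\mathcal{R}(T)$ is closed and $\mathrm{dis}(T)=0$. $T$ is zeroloid if $\mathrm{acc}\,\sigma(T)\subset\{0\}$. $T\in L(X)$ is $g_z$-Kato if there is $(M,N)\in\mathrm{Red}(T)$ such that $T_M$ is semi-regular and $T_N$ is zeroloid.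
   Formalization: In dis(T), the kernels N(T_[m]) and N(T_[r]) are required equal, not just their dimensions α (same if finite-dimensional). With α the claim fails: V⊕A, V a backward shift of infinite multiplicity, A(u,v)=(0,u+xv) on L²[0,1]²; its spectrum contains (0,1) but not 0. *)

theory Defs
  imports "HOL-Analysis.Analysis" "HOL-Library.Extended_Nat"
begin

section \<open>Complex Banach spaces\<close>

class complex_normed_vector = real_normed_vector +
  fixes scaleC :: "complex \<Rightarrow> 'a \<Rightarrow> 'a" (infixr "*\<^sub>C" 75)
  assumes scaleC_add_right: "c *\<^sub>C (x + y) = c *\<^sub>C x + c *\<^sub>C y"
    and scaleC_add_left: "(c + d) *\<^sub>C x = c *\<^sub>C x + d *\<^sub>C x"
    and scaleC_scaleC: "c *\<^sub>C d *\<^sub>C x = (c * d) *\<^sub>C x"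
    and scaleC_one: "1 *\<^sub>C x = x"
    and scaleR_scaleC: "r *\<^sub>R x = complex_of_real r *\<^sub>C x"
    and norm_scaleC: "norm (c *\<^sub>C x) = cmod c * norm x"

class complex_banach = complex_normed_vector + banach

global_interpretation complex_vector:
  vector_space "scaleC :: complex \<Rightarrow> 'a \<Rightarrow> 'a::complex_normed_vector"
  by unfold_locales
    (simp_all add: scaleC_add_right scaleC_add_left scaleC_scaleC scaleC_one)

section \<open>Operators on invariant subspaces\<close>

text \<open>
  A subspace cannot be a type depending on the operator, so the restriction of \<open>T\<close> to an
  invariant subspace \<open>M\<close> is the pair \<open>M\<close>, \<open>T\<close>: only the values of \<open>T\<close> on \<open>M\<close> matter.
  Operators on the whole space are the case \<open>M = UNIV\<close>.
\<close>

definition bounded_clinear_on :: "'a::complex_normed_vector set \<Rightarrow> ('a \<Rightarrow> 'a) \<Rightarrow> bool" where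
  "bounded_clinear_on M T \<longleftrightarrow>
     T ` M \<subseteq> M \<and>
     (\<forall>x\<in>M. \<forall>y\<in>M. T (x + y) = T x + T y) \<and>
     (\<forall>c. \<forall>x\<in>M. T (c *\<^sub>C x) = c *\<^sub>C T x) \<and>
     (\<exists>K. \<forall>x\<in>M. norm (T x) \<le> norm x * K)"

abbreviation bounded_clinear :: "('a::complex_normed_vector \<Rightarrow> 'a) \<Rightarrow> bool" where
  "bounded_clinear T \<equiv> bounded_clinear_on UNIV T"

definition invertible_on :: "'a::complex_normed_vector set \<Rightarrow> ('a \<Rightarrow> 'a) \<Rightarrow> bool" where
  "invertible_on M T \<longleftrightarrow>
     (\<exists>S. bounded_clinear_on M S \<and> (\<forall>x\<in>M. S (T x) = x \<and> T (S x) = x))"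

definition spectrum_on :: "'a::complex_normed_vector set \<Rightarrow> ('a \<Rightarrow> 'a) \<Rightarrow> complex set" where
  "spectrum_on M T = {c. \<not> invertible_on M (\<lambda>x. T x - c *\<^sub>C x)}"

definition kernel_on :: "'a::complex_normed_vector set \<Rightarrow> ('a \<Rightarrow> 'a) \<Rightarrow> 'a set" where
  "kernel_on M T = {x \<in> M. T x = 0}"

definition iter_range_on :: "'a::complex_normed_vector set \<Rightarrow> ('a \<Rightarrow> 'a) \<Rightarrow> nat \<Rightarrow> 'a set" where
  "iter_range_on M T n = (T ^^ n) ` M"

text \<open>
  Degree of stable iteration. \<open>kernel_on (iter_range_on M T n) T\<close> is the kernel
  \<open>N(T) \<inter> R(T^n)\<close> of the restriction \<open>T_[n]\<close> of \<open>T\<close> to \<open>R(T^n)\<close>. These kernels decrease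
  with \<open>n\<close>, and the degree is the index from which they are stationary. The stabilisation
  condition is often abbreviated as \<open>\<alpha>(T_[m]) = \<alpha>(T_[r])\<close> with \<open>\<alpha> = dim N\<close>; for
  finite-dimensional kernels this is the same condition (\<open>kernel_on_eq_iff_dim_eq\<close> below).
  For infinite-dimensional kernels the equality has to be read as equality of the nested
  kernels, not of their dimensions alone. Otherwise the direct sum of a backward shift of
  infinite multiplicity with an arbitrary operator of closed range would be semi-regular,
  and the \<open>g_z\<close>-Kato spectrum need not be closed: for \<open>V\<close> a backward shift of infinite
  multiplicity, \<open>A (u, v) = (0, u + B v)\<close> on \<open>L\<^sup>2[0,1] \<times> L\<^sup>2[0,1]\<close> and \<open>B\<close> multiplication
  by the variable, the spectrum of \<open>V \<oplus> A\<close> would contain the open interval from 0 to 1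
  but not 0.
\<close>

definition dis_on :: "'a::complex_normed_vector set \<Rightarrow> ('a \<Rightarrow> 'a) \<Rightarrow> enat" where
  "dis_on M T = Inf {enat m | m. \<forall>r\<ge>m.
     kernel_on (iter_range_on M T m) T = kernel_on (iter_range_on M T r) T}"

definition semi_regular_on :: "'a::complex_normed_vector set \<Rightarrow> ('a \<Rightarrow> 'a) \<Rightarrow> bool" where
  "semi_regular_on M T \<longleftrightarrow> closed (T ` M) \<and> dis_on M T = 0"

definition zeroloid_on :: "'a::complex_normed_vector set \<Rightarrow> ('a \<Rightarrow> 'a) \<Rightarrow> bool" where
  "zeroloid_on M T \<longleftrightarrow> {z. z islimpt spectrum_on M T} \<subseteq> {0}"

section \<open>The \<open>g_z\<close>-Kato spectrum\<close>

definition Red :: "('a::complex_normed_vector \<Rightarrow> 'a) \<Rightarrow> ('a set \<times> 'a set) set" where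
  "Red T = {(M, N).
     complex_vector.subspace M \<and> closed M \<and> T ` M \<subseteq> M \<and>
     complex_vector.subspace N \<and> closed N \<and> T ` N \<subseteq> N \<and>
     M \<inter> N = {0} \<and> {x + y | x y. x \<in> M \<and> y \<in> N} = UNIV}"

definition gz_Kato :: "('a::complex_normed_vector \<Rightarrow> 'a) \<Rightarrow> bool" where
  "gz_Kato T \<longleftrightarrow> (\<exists>(M, N) \<in> Red T. semi_regular_on M T \<and> zeroloid_on N T)"

definition gz_Kato_spectrum :: "('a::complex_normed_vector \<Rightarrow> 'a) \<Rightarrow> complex set" where
  "gz_Kato_spectrum T = {c. \<not> gz_Kato (\<lambda>x. T x - c *\<^sub>C x)}"

section \<open>Kernel stabilisation in terms of dimensions\<close>

lemma (in vector_space) nested_subspaces_eq_iff_dim_eq: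
  assumes "subspace U" "subspace V" "U \<subseteq> V" "finite F" "V \<subseteq> span F"
  shows "U = V \<longleftrightarrow> dim U = dim V"
proof
  assume dims: "dim U = dim V"
  obtain B where B: "B \<subseteq> U" "independent B" "U \<subseteq> span B" "card B = dim U"
    using basis_exists by blast
  obtain C where C: "B \<subseteq> C" "C \<subseteq> V" "independent C" "V \<subseteq> span C"
    using maximal_independent_subset_extend[of B V] B \<open>U \<subseteq> V\<close> by blast
  have "finite C"
    using independent_span_bound[OF \<open>finite F\<close> C(3)] C(2) assms(5) by blast
  moreover have "card C = dim V"
    using basis_card_eq_dim[OF C(2) C(4) C(3)] .
  ultimately have "B = C"
    using card_subset_eq[OF _ C(1)] B(4) dims by simp
  then have "V \<subseteq> span B" using C by simp
  also have "span B \<subseteq> U" using span_minimal[OF B(1) assms(1)] .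
  finally show "U = V" using \<open>U \<subseteq> V\<close> by blast
qed simp

lemma kernel_on_eq_iff_dim_eq:
  fixes T :: "'a::complex_normed_vector \<Rightarrow> 'a"
  assumes T: "bounded_clinear_on M T" and M: "complex_vector.subspace M" and "m \<le> r"
    and fin: "finite F" "kernel_on (iter_range_on M T m) T \<subseteq> complex_vector.span F"
  shows "kernel_on (iter_range_on M T m) T = kernel_on (iter_range_on M T r) T \<longleftrightarrow>
    complex_vector.dim (kernel_on (iter_range_on M T m) T) =
    complex_vector.dim (kernel_on (iter_range_on M T r) T)"
proof -
  have add: "T (x + y) = T x + T y" and scl: "T (c *\<^sub>C x) = c *\<^sub>C T x" and inv: "T x \<in> M"
    if "x \<in> M" "y \<in> M" for x y c
    using T that unfolding bounded_clinear_on_def by auto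
  have zero: "T 0 = 0"
    using scl[of 0 0 0] complex_vector.subspace_0[OF M] by simp
  have pow_in: "(T ^^ n) x \<in> M" if "x \<in> M" for n x
    using that by (induction n) (auto intro: inv)
  have pow_add: "(T ^^ n) (x + y) = (T ^^ n) x + (T ^^ n) y" if "x \<in> M" "y \<in> M" for n x y
    using that by (induction n) (auto simp: add pow_in)
  have pow_scl: "(T ^^ n) (c *\<^sub>C x) = c *\<^sub>C (T ^^ n) x" if "x \<in> M" for n c x
    using that by (induction n) (auto simp: scl pow_in)
  have pow_zero: "(T ^^ n) 0 = 0" for n
    by (induction n) (auto simp: zero)
  have sub: "complex_vector.subspace (kernel_on (iter_range_on M T n) T)" for n
  proof (rule complex_vector.subspaceI)
    show "0 \<in> kernel_on (iter_range_on M T n) T"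
      using complex_vector.subspace_0[OF M] pow_zero[of n] zero
      by (force simp: kernel_on_def iter_range_on_def)
  next
    fix x y assume "x \<in> kernel_on (iter_range_on M T n) T" "y \<in> kernel_on (iter_range_on M T n) T"
    then obtain a b where "a \<in> M" "b \<in> M" "x = (T ^^ n) a" "y = (T ^^ n) b" "T x = 0" "T y = 0"
      by (auto simp: kernel_on_def iter_range_on_def)
    then show "x + y \<in> kernel_on (iter_range_on M T n) T"
      using pow_add[of a b n] complex_vector.subspace_add[OF M, of a b] add[of x y] pow_in
      by (auto simp: kernel_on_def iter_range_on_def image_iff intro!: bexI[of _ "a + b"])
  next
    fix c x assume "x \<in> kernel_on (iter_range_on M T n) T"
    then obtain a where "a \<in> M" "x = (T ^^ n) a" "T x = 0"
      by (auto simp: kernel_on_def iter_range_on_def)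
    then show "c *\<^sub>C x \<in> kernel_on (iter_range_on M T n) T"
      using pow_scl[of a n c] complex_vector.subspace_scale[OF M, of a c] scl[of x x c] pow_in
      by (auto simp: kernel_on_def iter_range_on_def image_iff intro!: bexI[of _ "c *\<^sub>C a"])
  qed
  have "iter_range_on M T r \<subseteq> iter_range_on M T m"
  proof
    fix y assume "y \<in> iter_range_on M T r"
    then obtain a where a: "a \<in> M" "y = (T ^^ r) a" by (auto simp: iter_range_on_def)
    have "(T ^^ r) a = (T ^^ m) ((T ^^ (r - m)) a)"
      using \<open>m \<le> r\<close> by (metis comp_apply funpow_add le_add_diff_inverse)
    then show "y \<in> iter_range_on M T m"
      using a pow_in by (auto simp: iter_range_on_def)
  qed
  then have "kernel_on (iter_range_on M T r) T \<subseteq> kernel_on (iter_range_on M T m) T"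
    by (auto simp: kernel_on_def)
  from complex_vector.nested_subspaces_eq_iff_dim_eq[OF sub sub this fin] show ?thesis
    by metis
qed

end

theory Submission
  imports Defs "HOL-Complex_Analysis.Cauchy_Integral_Formula"
begin

text \<open>
  The set of all \<open>c\<close> for which \<open>T - c\<close> is \<open>g_z\<close>-Kato contains every \<open>c\<close> of large modulus, where
  \<open>T - c\<close> is invertible (\<open>gz_Kato_large_shift\<close>). So the spectrum is bounded, and it remains to see
  that this set is open: if \<open>T\<close> is \<open>g_z\<close>-Kato, then so is \<open>T - c\<close> for small \<open>c\<close>
  (\<open>gz_Kato_small_shift\<close>).

  Let \<open>T\<close> be semi-regular on \<open>M\<close> and zeroloid on the complement \<open>N\<close>, and let \<open>c\<close> be small and
  different from \<open>0\<close>. Semi-regularity on \<open>M\<close> survives the shift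
  (\<open>semi_regular_on_small_shift\<close>): the intersection of the ranges of the powers of \<open>T\<close> is a closed
  subspace on which \<open>T\<close> is onto and modulo which \<open>T\<close> is bounded below, and both properties are
  stable. On \<open>N\<close> the shifted operator need not be zeroloid, because the spectrum may now accumulate
  at \<open>-c\<close>. But \<open>c\<close> is not an accumulation point of the spectrum of \<open>T\<close> on \<open>N\<close>, so the Riesz
  projection splits \<open>N\<close> into a part on which \<open>T - c\<close> has spectrum at most \<open>{0}\<close> and a part on which
  it is invertible (\<open>isolated_point_projection\<close>). The invertible part is moved from \<open>N\<close> to \<open>M\<close>.

  The tools are the open mapping theorem, in the form that a bounded operator with closed range
  has preimages of controlled norm, and the Riesz projection, written as a mean of
  \<open>z (z - A)\<^sup>-\<^sup>1\<close> over a circle around \<open>0\<close>.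
\<close>

section \<open>Controlled preimages and the open mapping theorem\<close>

text \<open>
  Correcting the error again and again halves it each time, so the corrections form a geometric
  series, whose sum is an exact preimage. This is the common core of the open
  mapping theorem, of the closed range criterion and of the Neumann series arguments below; the set \<open>Y\<close> is whatever set the errors stay in.
\<close>

lemma exact_preimage_of_approximate_preimages:
  fixes T :: "'b::banach \<Rightarrow> 'c::real_normed_vector"
  assumes T: "bounded_linear T" and M: "subspace M" "closed M" and C: "0 \<le> C"
    and step: "\<And>y. y \<in> Y \<Longrightarrow>
      \<exists>x\<in>M. norm x \<le> C * norm y \<and> y - T x \<in> Y \<and> norm (y - T x) \<le> norm y / 2"
    and y: "y \<in> Y"
  shows "\<exists>x\<in>M. norm x \<le> 2 * C * norm y \<and> T x = y"
proof -
  interpret T: bounded_linear T by fact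
  from step obtain g where g: "\<And>y. y \<in> Y \<Longrightarrow>
      g y \<in> M \<and> norm (g y) \<le> C * norm y \<and> y - T (g y) \<in> Y \<and> norm (y - T (g y)) \<le> norm y / 2"
    by metis
  define r where "r n = ((\<lambda>y. y - T (g y)) ^^ n) y" for n
  have r_Suc: "r (Suc n) = r n - T (g (r n))" for n by (simp add: r_def)
  have r: "r n \<in> Y \<and> norm (r n) \<le> norm y * (1/2) ^ n" for n
  proof (induction n)
    case 0 then show ?case using y by (simp add: r_def)
  next
    case (Suc n)
    then show ?case using g[of "r n"] by (auto simp: r_Suc)
  qed
  define x where "x n = g (r n)" for n
  have x: "x n \<in> M" "norm (x n) \<le> C * norm y * (1/2) ^ n" for n
  proof -
    show "x n \<in> M" using g r by (simp add: x_def)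
    have "norm (x n) \<le> C * norm (r n)" using g r by (simp add: x_def)
    also have "\<dots> \<le> C * (norm y * (1/2) ^ n)" using r C by (intro mult_left_mono) auto
    finally show "norm (x n) \<le> C * norm y * (1/2) ^ n" by (simp add: mult.assoc)
  qed
  have geo: "summable (\<lambda>n. C * norm y * (1/2::real) ^ n)"
    by (intro summable_mult summable_geometric) simp
  have nsum: "summable (\<lambda>n. norm (x n))"
    using x(2) by (intro summable_comparison_test'[OF geo, where N = 0]) simp
  then have sums: "(\<lambda>n. \<Sum>k<n. x k) \<longlonglongrightarrow> suminf x"
    using summable_LIMSEQ summable_norm_cancel by blast
  have partial: "T (\<Sum>k<n. x k) = y - r n" for n
  proof (induction n)
    case 0 then show ?case by (simp add: r_def T.zero)
  next
    case (Suc n) then show ?case by (simp add: T.add r_Suc x_def)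
  qed
  have "(\<lambda>n. norm y * (1/2::real) ^ n) \<longlonglongrightarrow> norm y * 0"
    by (intro tendsto_intros LIMSEQ_power_zero) simp
  then have "(\<lambda>n. norm y * (1/2::real) ^ n) \<longlonglongrightarrow> 0" by simp
  then have "r \<longlonglongrightarrow> 0"
    by (rule Lim_null_comparison[OF always_eventually, rotated]) (use r in blast)
  then have "(\<lambda>n. T (\<Sum>k<n. x k)) \<longlonglongrightarrow> y - 0"
    unfolding partial by (intro tendsto_intros)
  moreover have "(\<lambda>n. T (\<Sum>k<n. x k)) \<longlonglongrightarrow> T (suminf x)"
    using sums by (rule T.tendsto)
  ultimately have "T (suminf x) = y - 0" by (rule LIMSEQ_unique[rotated])
  then have "T (suminf x) = y" by simp
  moreover have "suminf x \<in> M"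
    by (rule closed_sequentially[OF M(2) _ sums]) (intro subspace_sum[OF M(1)] x(1))
  moreover have "norm (suminf x) \<le> 2 * C * norm y"
  proof -
    have "norm (suminf x) \<le> (\<Sum>n. norm (x n))" using nsum by (rule summable_norm)
    also have "\<dots> \<le> (\<Sum>n. C * norm y * (1/2) ^ n)" using x(2) nsum geo by (rule suminf_le)
    also have "\<dots> = C * norm y * 2"
      by (subst suminf_mult) (simp_all add: suminf_geometric summable_geometric)
    finally show ?thesis by simp
  qed
  ultimately show ?thesis by blast
qed

text \<open>
  The images of the balls of integer radius cover the complete space \<open>T ` M\<close>, so by Baire's theorem
  the closure of one of them contains a relative ball. Differences of its points approximate every
  small vector, and scaling turns this into approximate preimages of every vector, with a fixed
  ratio between the norms.
\<close>

theorem open_mapping: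
  fixes T :: "'b::banach \<Rightarrow> 'c::banach"
  assumes T: "bounded_linear T" and M: "subspace M" "closed M" and cl: "closed (T ` M)"
  shows "\<exists>C>0. \<forall>y\<in>T ` M. \<exists>x\<in>M. norm x \<le> C * norm y \<and> T x = y"
proof -
  interpret T: bounded_linear T by fact
  define Y where "Y = T ` M"
  have Y: "subspace Y" unfolding Y_def using T.linear_axioms M(1) by (rule linear_subspace_image)
  define B where "B n = closure (T ` (M \<inter> cball 0 (real n)))" for n
  have BY: "B n \<subseteq> Y" for n
    unfolding B_def Y_def by (intro closure_minimal cl) auto
  have union: "\<Union> (range B) = Y"
  proof
    show "Y \<subseteq> \<Union> (range B)"
    proof
      fix y assume "y \<in> Y"
      then obtain x where x: "x \<in> M" "y = T x" by (auto simp: Y_def)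
      obtain n where "norm x \<le> real n" using real_arch_simple by blast
      then have "y \<in> B n" using x unfolding B_def
        by (intro closure_subset[THEN subsetD]) auto
      then show "y \<in> \<Union> (range B)" by blast
    qed
  qed (use BY in auto)
  have "\<exists>n. (top_of_set Y) interior_of (B n) \<noteq> {}"
  proof (rule ccontr)
    assume "\<nexists>n. (top_of_set Y) interior_of (B n) \<noteq> {}"
    moreover have "completely_metrizable_space (top_of_set Y)"
      using cl by (intro completely_metrizable_space_closedin completely_metrizable_space_euclidean)
        (simp add: Y_def)
    moreover have "closedin (top_of_set Y) (B n)" for n
      using BY by (intro closed_subset) (auto simp: B_def)
    ultimately have "(top_of_set Y) interior_of \<Union> (range B) = {}"
      by (intro Baire_category_alt) auto
    then have "Y = {}" unfolding union using interior_of_topspace[of "top_of_set Y"] by simp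
    then show False using subspace_0[OF Y] by simp
  qed
  then obtain n y0 where "y0 \<in> (top_of_set Y) interior_of (B n)" by blast
  then obtain U where U: "openin (top_of_set Y) U" "y0 \<in> U" "U \<subseteq> B n"
    by (auto simp: interior_of_def)
  then obtain e where e: "e > 0" "ball y0 e \<inter> Y \<subseteq> U" and y0: "y0 \<in> Y"
    unfolding openin_contains_ball by blast
  \<comment> \<open>A small \<open>y\<close> is the difference of \<open>y0 + y\<close> and \<open>y0\<close>,
    both of which are approximated by images of the ball of radius \<open>n\<close>.\<close>
  have small: "\<exists>x\<in>M. norm x \<le> 2 * real n \<and> norm (y - T x) \<le> d"
    if y: "y \<in> Y" "norm y < e" and d: "d > 0" for y d
  proof -
    have "y0 + y \<in> ball y0 e \<inter> Y" using y0 y subspace_add[OF Y] by (auto simp: dist_norm)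
    then have "y0 + y \<in> B n" "y0 \<in> B n" using U e by auto
    moreover have "\<exists>x\<in>M. norm x \<le> real n \<and> norm (v - T x) < d/2" if v: "v \<in> B n" for v
      using v d unfolding B_def closure_approachable
      by (drule_tac spec[of _ "d/2"]) (auto simp: dist_norm norm_minus_commute)
    ultimately obtain a b where ab: "a \<in> M" "norm a \<le> real n" "norm (y0 + y - T a) < d/2"
      "b \<in> M" "norm b \<le> real n" "norm (y0 - T b) < d/2" by meson
    have "norm (y - T (a - b)) = norm ((y0 + y - T a) - (y0 - T b))"
      by (simp add: T.diff algebra_simps)
    also have "\<dots> \<le> d" using norm_triangle_ineq4[of "y0 + y - T a" "y0 - T b"] ab by linarith
    finally have "norm (y - T (a - b)) \<le> d" .
    moreover have "norm (a - b) \<le> 2 * real n" using norm_triangle_ineq4[of a b] ab by linarith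
    ultimately show ?thesis using ab subspace_diff[OF M(1)] by blast
  qed
  define C where "C = 4 * real n / e"
  have step: "\<exists>x\<in>M. norm x \<le> C * norm y \<and> y - T x \<in> Y \<and> norm (y - T x) \<le> norm y / 2"
    if y: "y \<in> Y" for y
  proof (cases "y = 0")
    case True
    then show ?thesis using subspace_0[OF M(1)] subspace_0[OF Y] by (intro bexI[of _ 0]) (auto simp: T.zero)
  next
    case False
    \<comment> \<open>After division by \<open>c\<close> the vector has norm \<open>e / 2\<close>, inside the ball found above.\<close>
    define c where "c = 2 * norm y / e"
    have c: "c > 0" using False e by (simp add: c_def)
    have "(1/c) *\<^sub>R y \<in> Y" using y subspace_scale[OF Y] by blast
    moreover have "norm ((1/c) *\<^sub>R y) < e" using False e by (simp add: c_def field_simps)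
    moreover have "norm y / (2 * c) > 0" using False c by simp
    ultimately obtain x where x: "x \<in> M" "norm x \<le> 2 * real n"
        "norm ((1/c) *\<^sub>R y - T x) \<le> norm y / (2 * c)"
      using small by blast
    have "y - T (c *\<^sub>R x) = c *\<^sub>R ((1/c) *\<^sub>R y - T x)"
      using c by (simp add: T.scaleR algebra_simps)
    then have "norm (y - T (c *\<^sub>R x)) = c * norm ((1/c) *\<^sub>R y - T x)"
      using c by simp
    also have "\<dots> \<le> c * (norm y / (2 * c))" using x c by (intro mult_left_mono) auto
    finally have "norm (y - T (c *\<^sub>R x)) \<le> norm y / 2" using c by simp
    moreover have "norm (c *\<^sub>R x) \<le> C * norm y"
    proof -
      have "norm (c *\<^sub>R x) = c * norm x" using c by simp
      also have "\<dots> \<le> c * (2 * real n)" using x(2) c by (intro mult_left_mono) auto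
      also have "\<dots> = C * norm y" by (simp add: C_def c_def)
      finally show ?thesis .
    qed
    moreover have cx: "c *\<^sub>R x \<in> M" using x subspace_scale[OF M(1)] by blast
    moreover have "T (c *\<^sub>R x) \<in> Y" using cx unfolding Y_def by (rule imageI)
    then have "y - T (c *\<^sub>R x) \<in> Y" using y by (intro subspace_diff[OF Y])
    ultimately show ?thesis by blast
  qed
  have "\<exists>x\<in>M. norm x \<le> 2 * C * norm y \<and> T x = y" if "y \<in> Y" for y
    by (rule exact_preimage_of_approximate_preimages[OF T M _ step that]) (auto simp: C_def e less_imp_le)
  moreover have "2 * C * norm y \<le> (2 * C + 1) * norm y" for y :: 'c
    by (intro mult_right_mono) auto
  ultimately have "\<forall>y\<in>Y. \<exists>x\<in>M. norm x \<le> (2 * C + 1) * norm y \<and> T x = y"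
    by (meson order_trans)
  moreover have "0 \<le> C" using e(1) by (simp add: C_def)
  then have "2 * C + 1 > 0" by simp
  ultimately show ?thesis unfolding Y_def by blast
qed

lemma subspace_closure:
  fixes S :: "'a::real_normed_vector set"
  assumes S: "subspace S"
  shows "subspace (closure S)"
proof (rule subspaceI)
  show "0 \<in> closure S" using subspace_0[OF S] closure_subset by blast
next
  fix x y assume "x \<in> closure S" "y \<in> closure S"
  then obtain a b where "\<And>n. a n \<in> S" "a \<longlonglongrightarrow> x" "\<And>n. b n \<in> S" "b \<longlonglongrightarrow> y"
    unfolding closure_sequential by blast
  then show "x + y \<in> closure S"
    unfolding closure_sequential
    by (intro exI[of _ "\<lambda>n. a n + b n"]) (auto intro: tendsto_add subspace_add[OF S])
next
  fix c :: real and x assume "x \<in> closure S"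
  then obtain a where "\<And>n. a n \<in> S" "a \<longlonglongrightarrow> x"
    unfolding closure_sequential by blast
  then show "c *\<^sub>R x \<in> closure S"
    unfolding closure_sequential
    by (intro exI[of _ "\<lambda>n. c *\<^sub>R a n"]) (auto intro: tendsto_intros subspace_scale[OF S])
qed

text \<open>
  The converse of the open mapping theorem: a point of the closure of \<open>T ` M\<close> is within half its
  norm of a point of \<open>T ` M\<close>, and the error remains in the closure.
\<close>

lemma closed_image_of_controlled_preimages:
  fixes T :: "'b::banach \<Rightarrow> 'c::real_normed_vector"
  assumes T: "bounded_linear T" and M: "subspace M" "closed M" and C: "0 \<le> C"
    and pre: "\<And>y. y \<in> T ` M \<Longrightarrow> \<exists>x\<in>M. norm x \<le> C * norm y \<and> T x = y"
  shows "closed (T ` M)"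
proof -
  interpret T: bounded_linear T by fact
  have sub: "subspace (closure (T ` M))"
    using T.linear_axioms M(1) by (intro subspace_closure linear_subspace_image)
  have step: "\<exists>x\<in>M. norm x \<le> 2 * C * norm y \<and> y - T x \<in> closure (T ` M) \<and>
      norm (y - T x) \<le> norm y / 2" if y: "y \<in> closure (T ` M)" for y
  proof (cases "y = 0")
    case True
    then show ?thesis using subspace_0[OF M(1)] subspace_0[OF sub] by (intro bexI[of _ 0]) (auto simp: T.zero)
  next
    case False
    then obtain v where v: "v \<in> T ` M" "norm (v - y) < norm y / 2"
      using y unfolding closure_approachable dist_norm
      by (meson half_gt_zero_iff zero_less_norm_iff)
    obtain x where x: "x \<in> M" "norm x \<le> C * norm v" "T x = v" using pre v by blast
    have "norm v \<le> norm (v - y) + norm y" by (metis diff_add_cancel norm_triangle_ineq)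
    moreover have "0 \<le> norm y" by simp
    ultimately have "norm v \<le> 2 * norm y" using v(2) by linarith
    then have "C * norm v \<le> C * (2 * norm y)" using C by (intro mult_left_mono)
    then have "norm x \<le> 2 * C * norm y" using x by simp
    moreover have "y - T x \<in> closure (T ` M)"
      using y x(3) v(1) closure_subset[of "T ` M"] by (auto intro!: subspace_diff[OF sub])
    moreover have "norm (y - T x) \<le> norm y / 2" using x v by (simp add: norm_minus_commute)
    ultimately show ?thesis using x(1) by blast
  qed
  have "closure (T ` M) \<subseteq> T ` M"
  proof
    fix y assume "y \<in> closure (T ` M)"
    from exact_preimage_of_approximate_preimages[OF T M _ step this] C
    show "y \<in> T ` M" by auto
  qed
  then show ?thesis by (simp add: closure_subset_eq)
qed

section \<open>Complex-linear operators\<close>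

lemma bounded_bilinear_scaleC:
  "bounded_bilinear (scaleC :: complex \<Rightarrow> 'a \<Rightarrow> 'a::complex_normed_vector)"
proof
  show "(r *\<^sub>R a) *\<^sub>C b = r *\<^sub>R (a *\<^sub>C b)" for r a and b :: 'a
    by (simp add: scaleR_scaleC scaleC_scaleC scaleR_conv_of_real)
  show "a *\<^sub>C (r *\<^sub>R b) = r *\<^sub>R (a *\<^sub>C b)" for r a and b :: 'a
    by (simp add: scaleR_scaleC scaleC_scaleC mult.commute)
  show "\<exists>K. \<forall>a (b::'a). norm (a *\<^sub>C b) \<le> norm a * norm b * K"
    by (intro exI[of _ 1]) (simp add: norm_scaleC)
qed (simp_all add: scaleC_add_left scaleC_add_right)

lemma subspace_of_complex_subspace:
  "complex_vector.subspace M \<Longrightarrow> subspace M"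
  by (simp add: complex_vector.subspace_def subspace_def scaleR_scaleC)

lemma bounded_clinear_iff:
  "bounded_clinear T \<longleftrightarrow> bounded_linear T \<and> (\<forall>c x. T (c *\<^sub>C x) = c *\<^sub>C T x)"
proof
  assume T: "bounded_clinear T"
  then obtain K where K: "\<And>x. norm (T x) \<le> norm x * K"
    by (auto simp: bounded_clinear_on_def)
  have "bounded_linear T"
    by (rule bounded_linear_intro[where K = K])
      (use T K in \<open>auto simp: bounded_clinear_on_def scaleR_scaleC\<close>)
  then show "bounded_linear T \<and> (\<forall>c x. T (c *\<^sub>C x) = c *\<^sub>C T x)"
    using T by (auto simp: bounded_clinear_on_def)
next
  assume T: "bounded_linear T \<and> (\<forall>c x. T (c *\<^sub>C x) = c *\<^sub>C T x)"
  then show "bounded_clinear T"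
    using bounded_linear.bounded[of T] linear_add[OF bounded_linear.linear[of T]]
    by (simp add: bounded_clinear_on_def)
qed

lemma bounded_clinear_shift:
  assumes "bounded_clinear T"
  shows "bounded_clinear (\<lambda>x. T x - c *\<^sub>C x)"
proof -
  have "bounded_linear (\<lambda>x. T x - c *\<^sub>C x)"
    using assms
    by (intro bounded_linear_sub bounded_bilinear.bounded_linear_right[OF bounded_bilinear_scaleC])
      (simp add: bounded_clinear_iff)
  then show ?thesis
    using assms by (simp add: bounded_clinear_iff complex_vector.scale_right_diff_distrib
        scaleC_scaleC mult.commute)
qed

section \<open>Stability of semi-regularity under small shifts\<close>

text \<open>
  The kernels decrease with the exponent, so they are all equal exactly when the largest one, the
  kernel on \<open>M\<close>, is contained in every range.
\<close>

lemma dis_on_eq_0_iff: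
  assumes "T ` M \<subseteq> M"
  shows "dis_on M T = 0 \<longleftrightarrow> (\<forall>x\<in>M. T x = 0 \<longrightarrow> (\<forall>n. x \<in> (T ^^ n) ` M))"
proof -
  define A where "A = {enat m | m. \<forall>r\<ge>m.
     kernel_on (iter_range_on M T m) T = kernel_on (iter_range_on M T r) T}"
  have pow: "(T ^^ n) ` M \<subseteq> M" for n
    using assms by (induction n) (auto simp: image_subset_iff)
  have "Inf A = 0 \<longleftrightarrow> 0 \<in> A"
  proof
    assume *: "Inf A = 0"
    then have "A \<noteq> {}" by (auto simp: Inf_enat_def)
    then show "0 \<in> A" using * LeastI[of "\<lambda>x. x \<in> A"] by (auto simp: Inf_enat_def)
  next
    assume "0 \<in> A"
    then have "Inf A \<le> 0" by (rule Inf_lower)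
    then show "Inf A = 0" by simp
  qed
  also have "0 \<in> A \<longleftrightarrow> (\<forall>r. kernel_on M T = kernel_on ((T ^^ r) ` M) T)"
    by (auto simp: A_def iter_range_on_def zero_enat_def)
  also have "\<dots> \<longleftrightarrow> (\<forall>x\<in>M. T x = 0 \<longrightarrow> (\<forall>n. x \<in> (T ^^ n) ` M))"
  proof -
    have "kernel_on M T = kernel_on ((T ^^ r) ` M) T \<longleftrightarrow> (\<forall>x\<in>M. T x = 0 \<longrightarrow> x \<in> (T ^^ r) ` M)" for r
      using pow[of r] unfolding kernel_on_def by blast
    then show ?thesis by blast
  qed
  finally show ?thesis by (simp add: dis_on_def A_def)
qed

lemma semi_regular_on_iff:
  assumes "T ` M \<subseteq> M"
  shows "semi_regular_on M T \<longleftrightarrow>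
    closed (T ` M) \<and> (\<forall>x\<in>M. T x = 0 \<longrightarrow> (\<forall>n. x \<in> (T ^^ n) ` M))"
  by (simp add: semi_regular_on_def dis_on_eq_0_iff[OF assms])

lemma bounded_linear_funpow:
  fixes T :: "'a::real_normed_vector \<Rightarrow> 'a"
  assumes "bounded_linear T"
  shows "bounded_linear (T ^^ n)"
proof (induction n)
  case 0
  show ?case using bounded_linear_ident by (simp flip: id_def)
next
  case (Suc n)
  show ?case using bounded_linear_compose[OF assms Suc] by (simp add: o_def)
qed

text \<open>
  Ignoring the term \<open>c *\<^sub>C x\<close> leaves an error of at most half the norm, by the bound on \<open>c\<close>; the
  error lies in \<open>Y\<close> because \<open>Y\<close> is a subspace.
\<close>

lemma controlled_preimages_shift_onto:
  fixes T :: "'a::complex_banach \<Rightarrow> 'a"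
  assumes T: "bounded_clinear T"
    and Y: "complex_vector.subspace Y" "closed Y"
    and C: "0 \<le> C" "2 * C * cmod c \<le> 1"
    and pre: "\<And>v. v \<in> Y \<Longrightarrow> \<exists>x\<in>Y. norm x \<le> C * norm v \<and> T x = v"
    and y: "y \<in> Y"
  shows "\<exists>u\<in>Y. norm u \<le> 2 * C * norm y \<and> T u - c *\<^sub>C u = y"
proof (rule exact_preimage_of_approximate_preimages[OF _ _ Y(2) C(1) _ y])
  show "bounded_linear (\<lambda>x. T x - c *\<^sub>C x)"
    using bounded_clinear_shift[OF T] by (simp add: bounded_clinear_iff)
  show "subspace Y" using Y(1) by (rule subspace_of_complex_subspace)
  fix v assume "v \<in> Y"
  then obtain x where x: "x \<in> Y" "norm x \<le> C * norm v" "T x = v" using pre by blast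
  have "norm (c *\<^sub>C x) \<le> cmod c * (C * norm v)"
    using x by (auto simp: norm_scaleC intro: mult_left_mono)
  also have "\<dots> = (2 * C * cmod c) * norm v / 2" by simp
  also have "\<dots> \<le> norm v / 2" using C mult_right_mono[OF C(2), of "norm v"] by simp
  finally have "norm (c *\<^sub>C x) \<le> norm v / 2" .
  then show "\<exists>x\<in>Y. norm x \<le> C * norm v \<and> v - (T x - c *\<^sub>C x) \<in> Y \<and>
      norm (v - (T x - c *\<^sub>C x)) \<le> norm v / 2"
    using x complex_vector.subspace_scale[OF Y(1)] by (intro bexI[of _ x]) auto
qed

text \<open>
  In the application \<open>Y\<close> is the intersection of all ranges of powers of \<open>T\<close> on \<open>M\<close>. On \<open>Y\<close> the
  operator \<open>T\<close> is onto, hence so is \<open>T - c\<close>; this puts \<open>Y\<close> into every range of \<open>T - c\<close>, and \<open>Y\<close>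
  contains the eigenvectors, so the kernel condition holds. Modulo \<open>Y\<close> the operator \<open>T\<close> is
  injective with closed range, hence bounded below, and so is \<open>T - c\<close>. Lifting from the quotient
  back to \<open>M\<close> gives preimages of controlled norm, hence a closed range. The quotient norm appears
  below as the distance to \<open>Y\<close>.
\<close>

lemma semi_regular_on_shift:
  fixes T :: "'a::complex_banach \<Rightarrow> 'a"
  assumes T: "bounded_clinear T"
    and M: "complex_vector.subspace M" "closed M" "T ` M \<subseteq> M"
    and Y: "complex_vector.subspace Y" "closed Y" "Y \<subseteq> M" "T ` Y \<subseteq> Y" "Y \<subseteq> T ` M"
    and absorb: "\<And>x. x \<in> M \<Longrightarrow> T x \<in> Y \<Longrightarrow> x \<in> Y"
    and eigen: "\<And>x. x \<in> M \<Longrightarrow> T x = c *\<^sub>C x \<Longrightarrow> x \<in> Y"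
    and C: "0 \<le> C" "4 * C * cmod c \<le> 1"
    and pre: "\<And>v. v \<in> T ` M \<Longrightarrow> \<exists>x\<in>M. norm x \<le> C * norm v \<and> T x = v"
  shows "semi_regular_on M (\<lambda>x. T x - c *\<^sub>C x)"
proof -
  define S where "S x = T x - c *\<^sub>C x" for x
  have Slin: "bounded_linear S" and Tlin: "bounded_linear T"
    using T bounded_clinear_shift[OF T] by (simp_all add: S_def[abs_def] bounded_clinear_iff)
  interpret S: bounded_linear S by fact
  interpret T: bounded_linear T by fact
  have "2 * C * cmod c \<le> 1" using C norm_ge_zero[of c] mult_nonneg_nonneg[of C "cmod c"] by linarith
  moreover have "\<exists>x\<in>Y. norm x \<le> C * norm v \<and> T x = v" if "v \<in> Y" for v
    using pre[of v] that Y absorb by (metis subsetD)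
  ultimately have onto: "\<exists>u\<in>Y. norm u \<le> 2 * C * norm y \<and> S u = y" if "y \<in> Y" for y
    unfolding S_def using controlled_preimages_shift_onto[OF T Y(1,2) C(1)] that by blast
  have SY: "S y \<in> Y" if "y \<in> Y" for y
    unfolding S_def using that Y(4) by (intro complex_vector.subspace_diff[OF Y(1)] complex_vector.subspace_scale[OF Y(1)]) auto
  have SM: "S ` M \<subseteq> M"
    unfolding S_def using M(3)
    by (intro image_subsetI complex_vector.subspace_diff[OF M(1)] complex_vector.subspace_scale[OF M(1)]) auto
  obtain K where K: "0 \<le> K" "\<And>x. norm (S x) \<le> norm x * K"
    using S.nonneg_bounded by blast
  define D where "D = 4 * C + 2 * C * (1 + 4 * C * K)"
  have D: "0 \<le> D" "2 * C \<le> D" using C K by (auto simp: D_def algebra_simps)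
  have controlled: "\<exists>x\<in>M. norm x \<le> D * norm v \<and> S x = v" if "v \<in> S ` M" for v
  proof -
    from that obtain x where x: "x \<in> M" "v = S x" by blast
    show ?thesis
    proof (cases "x \<in> Y")
      case True
      then obtain u where u: "u \<in> Y" "norm u \<le> 2 * C * norm v" "S u = v"
        using onto[of v] SY x by blast
      moreover have "2 * C * norm v \<le> D * norm v" using D by (intro mult_right_mono) auto
      ultimately show ?thesis using Y(3) by (intro bexI[of _ u]) auto
    next
      case False
      \<comment> \<open>Replace \<open>x\<close> by a representative \<open>x1\<close> of its class modulo \<open>Y\<close> that nearly attains the
        quotient norm \<open>d\<close>. Then \<open>d\<close> is bounded by a multiple of the norm of \<open>v\<close>, and
        the change made to the image is undone inside \<open>Y\<close>.\<close>
      define d where "d = infdist x Y"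
      have ne: "Y \<noteq> {}" using complex_vector.subspace_0[OF Y(1)] by blast
      have d: "d > 0" unfolding d_def
        using False ne Y(2) by (metis in_closed_iff_infdist_zero infdist_nonneg less_eq_real_def)
      then have "\<not> 2 * d \<le> d" by simp
      then obtain y where y: "y \<in> Y" "dist x y < 2 * d"
        unfolding d_def using ne by (metis infdist_notempty cINF_greatest not_le_imp_less)
      define x1 where "x1 = x - y"
      have x1: "norm x1 < 2 * d" using y by (simp add: x1_def dist_norm)
      obtain y0 where y0: "y0 \<in> Y" "T y0 = S y" using SY[OF y(1)] Y(5) Y(3) absorb by (metis imageE subsetD)
      have Mdiff: "a - b \<in> M" if "a \<in> M" "b \<in> M" for a b
        using that complex_vector.subspace_diff[OF M(1)] by blast
      have Madd: "a + b \<in> M" if "a \<in> M" "b \<in> M" for a b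
        using that complex_vector.subspace_add[OF M(1)] by blast
      have "x1 \<in> M" using x y Y(3) Mdiff by (auto simp: x1_def)
      \<comment> \<open>Solving for the right-hand side with control of the norm yields \<open>x'\<close> in the class of \<open>x\<close>
        modulo \<open>Y\<close>, so its norm bounds \<open>d\<close>; the term with \<open>c\<close> is absorbed into the left side.\<close>
      have "T (x1 + y0) = v + c *\<^sub>C x1"
        using y0 x by (simp add: x1_def S_def T.add T.diff complex_vector.scale_right_diff_distrib)
      moreover have "x1 + y0 \<in> M" using \<open>x1 \<in> M\<close> y0 Y(3) Madd by auto
      ultimately obtain x' where x': "x' \<in> M" "norm x' \<le> C * norm (v + c *\<^sub>C x1)"
          "T x' = T (x1 + y0)"
        using pre[of "T (x1 + y0)"] by (metis imageI)
      have "x1 + y0 - x' \<in> Y"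
      proof (rule absorb)
        show "x1 + y0 - x' \<in> M" using \<open>x1 + y0 \<in> M\<close> x'(1) by (rule Mdiff)
        show "T (x1 + y0 - x') \<in> Y" using complex_vector.subspace_0[OF Y(1)] x'(3) by (simp add: T.diff)
      qed
      then have "(x1 + y0 - x') - y0 + y \<in> Y"
        by (rule complex_vector.subspace_add[OF Y(1) complex_vector.subspace_diff[OF Y(1) _ y0(1)] y(1)])
      then have "x - x' \<in> Y" by (simp add: x1_def algebra_simps)
      then have "d \<le> norm x'" unfolding d_def using infdist_le[of "x - x'" Y x] by (simp add: dist_norm)
      also have "\<dots> \<le> C * (norm v + cmod c * (2 * d))"
      proof -
        have "norm (v + c *\<^sub>C x1) \<le> norm v + cmod c * norm x1"
          by (metis norm_scaleC norm_triangle_ineq)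
        also have "\<dots> \<le> norm v + cmod c * (2 * d)"
          using x1 by (intro add_left_mono mult_left_mono) auto
        finally show ?thesis using x'(2) C(1) by (meson mult_left_mono order_trans)
      qed
      also have "\<dots> = C * norm v + (4 * C * cmod c) * d / 2" by (simp add: algebra_simps)
      also have "\<dots> \<le> C * norm v + d / 2"
        using mult_right_mono[OF C(2), of d] d by simp
      finally have "d \<le> 2 * (C * norm v)" by simp
      then have x1': "norm x1 \<le> 4 * C * norm v" using x1 by simp
      have "S y = v - S x1" using x by (simp add: x1_def S.diff)
      then have "norm (S y) \<le> norm v + norm (S x1)" by (simp add: norm_triangle_ineq4)
      also have "norm (S x1) \<le> 4 * C * norm v * K"
        using K(2)[of x1] mult_right_mono[OF x1' K(1)] by linarith
      finally have Sy: "norm (S y) \<le> norm v + 4 * C * norm v * K" by simp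
      obtain u where u: "u \<in> Y" "norm u \<le> 2 * C * norm (S y)" "S u = S y"
        using onto[OF SY[OF y(1)]] by blast
      have "2 * C * norm (S y) \<le> 2 * C * (norm v + 4 * C * norm v * K)"
        using Sy C by (intro mult_left_mono) auto
      then have "norm (x1 + u) \<le> 4 * C * norm v + 2 * C * (norm v + 4 * C * norm v * K)"
        using norm_triangle_ineq[of x1 u] x1' u(2) by linarith
      then have "norm (x1 + u) \<le> D * norm v" by (simp add: D_def algebra_simps)
      moreover have "S (x1 + u) = v" using u x by (simp add: x1_def S.diff S.add)
      moreover have "x1 + u \<in> M" using \<open>x1 \<in> M\<close> u Y(3) Madd by auto
      ultimately show ?thesis by blast
    qed
  qed
  have "closed (S ` M)"
    using closed_image_of_controlled_preimages[OF Slin subspace_of_complex_subspace[OF M(1)] M(2) D(1) controlled] .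
  moreover have "x \<in> (S ^^ n) ` M" if "x \<in> M" "S x = 0" for x n
  proof -
    have "\<exists>u\<in>Y. (S ^^ n) u = y" if "y \<in> Y" for y
      using that
    proof (induction n arbitrary: y)
      case (Suc n)
      then obtain u where "u \<in> Y" "S u = y" using onto by blast
      with Suc.IH[of u] show ?case by auto
    qed auto
    moreover have "x \<in> Y" using that by (intro eigen) (auto simp: S_def)
    ultimately show ?thesis using Y(3) by blast
  qed
  ultimately have "semi_regular_on M S" using semi_regular_on_iff[OF SM] by blast
  then show ?thesis by (simp add: S_def[abs_def])
qed

text \<open>
  The intersection \<open>Y\<close> of the ranges of the powers satisfies the hypotheses of the preceding lemma.
  What makes this work is that the kernel lies in every range: any preimage of a point of
  \<open>(T ^^ Suc n) ` M\<close> then lies in \<open>(T ^^ n) ` M\<close>, so controlled preimages can be taken repeatedly,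
  which closes all the ranges.
\<close>

theorem semi_regular_on_small_shift:
  fixes T :: "'a::complex_banach \<Rightarrow> 'a"
  assumes T: "bounded_clinear T"
    and M: "complex_vector.subspace M" "closed M" "T ` M \<subseteq> M"
    and reg: "semi_regular_on M T"
  shows "\<exists>e>0. \<forall>c. cmod c < e \<longrightarrow> semi_regular_on M (\<lambda>x. T x - c *\<^sub>C x)"
proof -
  have Tlin: "bounded_linear T" and Tscale: "\<And>c x. T (c *\<^sub>C x) = c *\<^sub>C T x"
    using T by (simp_all add: bounded_clinear_iff)
  interpret T: bounded_linear T by fact
  have Msub: "subspace M" using M(1) by (rule subspace_of_complex_subspace)
  from reg have cl: "closed (T ` M)" and ker: "\<And>x n. x \<in> M \<Longrightarrow> T x = 0 \<Longrightarrow> x \<in> (T ^^ n) ` M"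
    using semi_regular_on_iff[OF M(3)] by blast+
  obtain C where C: "C > 0" "\<And>v. v \<in> T ` M \<Longrightarrow> \<exists>x\<in>M. norm x \<le> C * norm v \<and> T x = v"
    using open_mapping[OF Tlin Msub M(2) cl] by blast
  have pow_linear: "bounded_linear (T ^^ n)" for n using Tlin by (rule bounded_linear_funpow)
  have pow_scale: "(T ^^ n) (c *\<^sub>C x) = c *\<^sub>C (T ^^ n) x" for n c x
    by (induction n) (auto simp: Tscale)
  have pow_sub: "complex_vector.subspace ((T ^^ n) ` M)" for n
    using complex_vector.subspace_0[OF M(1)] complex_vector.subspace_add[OF M(1)]
      complex_vector.subspace_scale[OF M(1)]
    by (auto simp: complex_vector.subspace_def image_iff pow_scale[symmetric]
        linear_add[OF bounded_linear.linear[OF pow_linear], symmetric]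
        linear_0[OF bounded_linear.linear[OF pow_linear]] intro: bexI[of _ 0])
  \<comment> \<open>Two preimages of a point differ by an element of the kernel, which lies in every range.\<close>
  have absorb_range: "x \<in> (T ^^ n) ` M" if "x \<in> M" "T x \<in> (T ^^ Suc n) ` M" for x n
  proof -
    from that obtain a where a: "a \<in> M" "T x = T ((T ^^ n) a)" by auto
    have in_M: "(T ^^ n) a \<in> M" using a(1) M(3) by (induction n) auto
    have "x - (T ^^ n) a \<in> (T ^^ n) ` M"
      using a that in_M complex_vector.subspace_diff[OF M(1)] by (intro ker) (auto simp: T.diff)
    then have "(x - (T ^^ n) a) + (T ^^ n) a \<in> (T ^^ n) ` M"
      using a by (intro complex_vector.subspace_add[OF pow_sub]) auto
    then show ?thesis by simp
  qed
  have pow_controlled: "\<exists>x\<in>M. norm x \<le> C ^ n * norm y \<and> (T ^^ n) x = y"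
    if "y \<in> (T ^^ n) ` M" for y n
    using that
  proof (induction n arbitrary: y)
    case (Suc n)
    have "y \<in> T ` M"
    proof -
      from Suc.prems obtain a where "a \<in> M" "y = T ((T ^^ n) a)" by auto
      moreover have "(T ^^ n) a \<in> M" using \<open>a \<in> M\<close> M(3) by (induction n) auto
      ultimately show ?thesis by blast
    qed
    then obtain x where x: "x \<in> M" "norm x \<le> C * norm y" "T x = y" using C(2) by blast
    then have "x \<in> (T ^^ n) ` M" using absorb_range Suc.prems by blast
    then obtain z where z: "z \<in> M" "norm z \<le> C ^ n * norm x" "(T ^^ n) z = x"
      using Suc.IH by blast
    have "C ^ n * norm x \<le> C ^ n * (C * norm y)" using x C(1) by (intro mult_left_mono) auto
    then show ?case using z x by (intro bexI[of _ z]) (auto simp: algebra_simps)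
  qed auto
  have pow_closed: "closed ((T ^^ n) ` M)" for n
    using pow_controlled C(1)
    by (intro closed_image_of_controlled_preimages[OF pow_linear Msub M(2), of "C ^ n"]) auto
  define Y where "Y = (\<Inter>n. (T ^^ n) ` M)"
  have Y: "complex_vector.subspace Y" "closed Y" "Y \<subseteq> M" "T ` Y \<subseteq> Y" "Y \<subseteq> T ` M"
  proof -
    show "complex_vector.subspace Y"
      unfolding Y_def by (intro complex_vector.subspace_Inter) (auto intro: pow_sub)
    show "closed Y" unfolding Y_def using pow_closed by blast
    show "Y \<subseteq> M" unfolding Y_def using INT_lower[of 0 UNIV "\<lambda>n. (T ^^ n) ` M"] by simp
    show "Y \<subseteq> T ` M" unfolding Y_def using INT_lower[of 1 UNIV "\<lambda>n. (T ^^ n) ` M"] by simp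
    show "T ` Y \<subseteq> Y"
    proof clarify
      fix y assume y: "y \<in> Y"
      have "T y \<in> (T ^^ n) ` M" for n
      proof -
        obtain a where "a \<in> M" "y = (T ^^ n) a" using y by (auto simp: Y_def)
        then have "T y = (T ^^ n) (T a)" "T a \<in> M" using M(3) by (auto simp: funpow_swap1)
        then show ?thesis by blast
      qed
      then show "T y \<in> Y" by (simp add: Y_def)
    qed
  qed
  have absorb: "x \<in> Y" if "x \<in> M" "T x \<in> Y" for x
  proof -
    have "x \<in> (T ^^ n) ` M" for n
    proof (rule absorb_range[OF that(1)])
      show "T x \<in> (T ^^ Suc n) ` M" using that(2) unfolding Y_def by (rule INT_D) (rule UNIV_I)
    qed
    then show ?thesis by (simp add: Y_def)
  qed
  have eigen: "x \<in> Y" if "x \<in> M" "T x = c *\<^sub>C x" "c \<noteq> 0" for x c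
  proof -
    have "x \<in> (T ^^ n) ` M" for n
    proof (induction n)
      case (Suc n)
      then obtain a where a: "a \<in> M" "x = (T ^^ n) a" by auto
      have "(T ^^ Suc n) ((1/c) *\<^sub>C a) = (1/c) *\<^sub>C T x" unfolding pow_scale using a by simp
      also have "\<dots> = x" using that by (simp add: scaleC_scaleC scaleC_one)
      finally have "x = (T ^^ Suc n) ((1/c) *\<^sub>C a)" by (rule sym)
      then show ?case by (rule image_eqI) (intro complex_vector.subspace_scale[OF M(1)] a(1))
    qed (use that in simp)
    then show ?thesis by (simp add: Y_def)
  qed
  have "semi_regular_on M (\<lambda>x. T x - c *\<^sub>C x)" if c: "cmod c < 1 / (4 * C)" for c
  proof (cases "c = 0")
    case True
    then show ?thesis using reg by simp
  next
    case False
    have "4 * C * cmod c \<le> 1" using c C(1) by (simp add: field_simps)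
    with False show ?thesis
      using C eigen absorb by (intro semi_regular_on_shift[OF T M Y, where C = C]) auto
  qed
  then show ?thesis using C(1) by (intro exI[of _ "1 / (4 * C)"]) auto
qed

section \<open>The Riesz projection of an isolated point\<close>

text \<open>
  Here \<open>0\<close> is at most an isolated point of the spectrum of \<open>A\<close>, and \<open>R z\<close> is the inverse of \<open>z - A\<close>
  for \<open>z\<close> in a punctured disc. The projection onto the spectral part at \<open>0\<close> is
  \<open>(1 / 2 \<pi> \<i>) \<integral> R z x dz\<close> over a small circle. Parametrising the circle by \<open>[0, 1]\<close> makes this the
  mean of \<open>z R z x\<close> over the circle, and the other operators needed are means of \<open>k z R z x\<close> for
  scalar weights \<open>k\<close>. The integrals are taken vector by vector.
\<close>

locale punctured_resolvent =
  fixes A :: "'a::complex_banach \<Rightarrow> 'a" and R :: "complex \<Rightarrow> 'a \<Rightarrow> 'a" and \<rho> :: real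
  assumes A: "bounded_clinear A" and rho: "0 < \<rho>"
    and R: "\<And>z. 0 < cmod z \<Longrightarrow> cmod z < \<rho> \<Longrightarrow> bounded_clinear (R z)"
    and R_left: "\<And>z x. 0 < cmod z \<Longrightarrow> cmod z < \<rho> \<Longrightarrow> R z (z *\<^sub>C x - A x) = x"
    and R_right: "\<And>z x. 0 < cmod z \<Longrightarrow> cmod z < \<rho> \<Longrightarrow> z *\<^sub>C R z x - A (R z x) = x"
begin

definition D :: "complex set" where "D = {z. 0 < cmod z \<and> cmod z < \<rho>}"

lemma open_D: "open D"
proof -
  have "D = ball 0 \<rho> - {0}" by (auto simp: D_def)
  then show ?thesis by (simp add: open_delete)
qed

lemma A_linear: "bounded_linear A" and A_scale: "A (c *\<^sub>C x) = c *\<^sub>C A x"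
  using A by (simp_all add: bounded_clinear_iff)

lemma R_linear: "z \<in> D \<Longrightarrow> bounded_linear (R z)"
  and R_scale: "z \<in> D \<Longrightarrow> R z (c *\<^sub>C x) = c *\<^sub>C R z x"
  using R[of z] by (simp_all add: bounded_clinear_iff D_def)

lemma R_add: "z \<in> D \<Longrightarrow> R z (x + y) = R z x + R z y"
  and R_diff: "z \<in> D \<Longrightarrow> R z (x - y) = R z x - R z y"
  using R_linear by (simp_all add: linear_add linear_diff bounded_linear.linear)

lemma R_left': "z \<in> D \<Longrightarrow> R z (z *\<^sub>C x - A x) = x"
  and R_right': "z \<in> D \<Longrightarrow> z *\<^sub>C R z x - A (R z x) = x"
  using R_left R_right by (simp_all add: D_def)

lemma resolvent_identity:
  assumes z: "z \<in> D" and w: "w \<in> D"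
  shows "R z x - R w x = (w - z) *\<^sub>C R z (R w x)"
proof -
  have "R z x - R w x = R z (w *\<^sub>C R w x - A (R w x)) - R z (z *\<^sub>C R w x - A (R w x))"
    by (simp only: R_left'[OF z] R_right'[OF w])
  also have "\<dots> = R z ((w - z) *\<^sub>C R w x)"
    by (simp add: R_diff[OF z, symmetric] complex_vector.scale_left_diff_distrib)
  finally show ?thesis by (simp add: R_scale[OF z])
qed

text \<open>
  Everything built from the resolvent below inherits this, so the Riesz projection commutes
  with each operator that commutes with \<open>A\<close>.
\<close>

lemma R_commute:
  assumes z: "z \<in> D" and U: "bounded_clinear U" "\<And>x. U (A x) = A (U x)"
  shows "U (R z x) = R z (U x)"
proof -
  have "R z (U (z *\<^sub>C R z x - A (R z x))) = U (R z x)"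
    using U R_left'[OF z, of "U (R z x)"]
    by (simp add: bounded_clinear_iff linear_diff bounded_linear.linear)
  then show ?thesis by (simp add: R_right'[OF z])
qed

text \<open>
  By the resolvent identity the norm of \<open>R z v\<close> is at most that of \<open>R w v\<close> plus a small multiple of
  itself, when \<open>z\<close> is near \<open>w\<close>.
\<close>

lemma R_locally_bounded:
  assumes w: "w \<in> D"
  shows "\<exists>d>0. \<exists>K\<ge>0. ball w d \<subseteq> D \<and> (\<forall>z\<in>ball w d. \<forall>v. norm (R z v) \<le> K * norm v)"
proof -
  obtain K where K: "0 \<le> K" "\<And>v. norm (R w v) \<le> norm v * K"
    using bounded_linear.nonneg_bounded[OF R_linear[OF w]] by blast
  obtain d where d: "d > 0" "ball w d \<subseteq> D"
    using open_D w by (auto simp: open_contains_ball)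
  define d' where "d' = min d (1 / (2 * K + 1))"
  have d': "d' > 0" "ball w d' \<subseteq> D" "d' * (2 * K) \<le> 1"
  proof -
    show "d' > 0" "ball w d' \<subseteq> D" using d K(1) by (auto simp: d'_def subset_iff)
    have "d' * (2 * K) \<le> 1 / (2 * K + 1) * (2 * K)"
      using K(1) by (intro mult_right_mono) (auto simp: d'_def)
    also have "\<dots> \<le> 1" using K(1) by (simp add: divide_le_eq)
    finally show "d' * (2 * K) \<le> 1" .
  qed
  have "norm (R z v) \<le> (2 * K) * norm v" if z: "z \<in> ball w d'" for z v
  proof -
    have zD: "z \<in> D" using z d' by blast
    have "R z v = R w v - (z - w) *\<^sub>C R w (R z v)"
      using resolvent_identity[OF w zD, of v] by (simp add: algebra_simps)
    then have "norm (R z v) \<le> norm (R w v) + norm ((z - w) *\<^sub>C R w (R z v))"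
      by (metis norm_triangle_ineq4)
    also have "\<dots> \<le> norm v * K + d' * (norm (R z v) * K)"
      unfolding norm_scaleC using z K d'(1)
      by (intro add_mono mult_mono) (auto simp: dist_norm norm_minus_commute)
    also have "d' * (norm (R z v) * K) = (d' * (2 * K)) * norm (R z v) / 2" by simp
    also have "\<dots> \<le> norm (R z v) / 2"
      using mult_right_mono[OF d'(3), of "norm (R z v)"] by simp
    finally show ?thesis by (simp add: field_simps)
  qed
  then show ?thesis using d' K(1) by (intro exI[of _ d'] exI[of _ "2 * K"] conjI) auto
qed

lemma R_bounded_on_compact:
  assumes S: "compact S" "S \<subseteq> D"
  shows "\<exists>K\<ge>0. \<forall>z\<in>S. \<forall>v. norm (R z v) \<le> K * norm v"
proof -
  obtain d K where dK: "\<And>w. w \<in> D \<Longrightarrow> d w > 0 \<and> 0 \<le> K w \<and>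
      (\<forall>z\<in>ball w (d w). \<forall>v. norm (R z v) \<le> K w * norm v)"
    using R_locally_bounded by metis
  have "\<And>w. w \<in> S \<Longrightarrow> open (ball w (d w))" "S \<subseteq> (\<Union>w\<in>S. ball w (d w))"
    using dK S(2) by fastforce+
  then obtain F where F: "F \<subseteq> S" "finite F" "S \<subseteq> (\<Union>w\<in>F. ball w (d w))"
    using compactE_image[OF S(1), of S "\<lambda>w. ball w (d w)"] by blast
  define B where "B = sum K F"
  have KB: "K w \<le> B" if "w \<in> F" for w
    unfolding B_def using that F dK S(2) by (intro member_le_sum) auto
  have "norm (R z v) \<le> B * norm v" if z: "z \<in> S" for z v
  proof -
    obtain w where w: "w \<in> F" "z \<in> ball w (d w)" using F(3) z by blast
    then have "norm (R z v) \<le> K w * norm v" using dK F(1) S(2) by blast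
    also have "\<dots> \<le> B * norm v" using KB[OF w(1)] by (intro mult_right_mono) auto
    finally show ?thesis .
  qed
  moreover have "0 \<le> B" unfolding B_def using dK F(1) S(2) by (intro sum_nonneg) auto
  ultimately show ?thesis by blast
qed

lemma continuous_on_R:
  assumes v: "continuous_on D v"
  shows "continuous_on D (\<lambda>z. R z (v z))"
  unfolding continuous_on_eq_continuous_at[OF open_D]
proof
  fix w assume w: "w \<in> D"
  obtain d K where d: "d > 0" "ball w d \<subseteq> D" and K: "K \<ge> 0"
    "\<And>z u. z \<in> ball w d \<Longrightarrow> norm (R z u) \<le> K * norm u"
    using R_locally_bounded[OF w] by blast
  define H where "H z = K * norm (v z - v w) + cmod (w - z) * (K * norm (R w (v w)))" for z
  have "(v \<longlongrightarrow> v w) (at w)"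
    using v w continuous_on_eq_continuous_at[OF open_D] by (auto simp: isCont_def)
  then have "(H \<longlongrightarrow> K * norm (v w - v w) + cmod (w - w) * (K * norm (R w (v w)))) (at w)"
    unfolding H_def by (intro tendsto_intros)
  then have H: "(H \<longlongrightarrow> 0) (at w)" by simp
  have "norm (R z (v z) - R w (v w)) \<le> H z" if z: "z \<in> ball w d" for z
  proof -
    have zD: "z \<in> D" using z d by blast
    have "R z (v z) - R w (v w) = R z (v z - v w) + (w - z) *\<^sub>C R z (R w (v w))"
      using resolvent_identity[OF zD w, of "v w"] by (simp add: R_diff[OF zD] algebra_simps)
    also have "norm \<dots> \<le> norm (R z (v z - v w)) + cmod (w - z) * norm (R z (R w (v w)))"
      by (metis norm_scaleC norm_triangle_ineq)
    also have "\<dots> \<le> H z"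
      unfolding H_def using K(2)[OF z] by (intro add_mono mult_left_mono) auto
    finally show ?thesis .
  qed
  moreover have "\<forall>\<^sub>F z in at w. z \<in> ball w d"
    using d(1) by (intro eventually_at_in_open') auto
  ultimately have "\<forall>\<^sub>F z in at w. norm (R z (v z) - R w (v w)) \<le> H z"
    by (rule eventually_mono[rotated])
  from Lim_null_comparison[OF this H]
  show "isCont (\<lambda>z. R z (v z)) w"
    unfolding isCont_def by (rule LIM_zero_cancel)
qed

lemma R_has_derivative:
  assumes w: "w \<in> D"
  shows "((\<lambda>z. R z x) has_derivative (\<lambda>h. - (h *\<^sub>C R w (R w x)))) (at w)"
proof -
  obtain d where d: "d > 0" "ball w d \<subseteq> D"
    using open_D w by (auto simp: open_contains_ball)
  show ?thesis
  proof (rule has_derivativeI_sandwich[OF d(1)])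
    show "bounded_linear (\<lambda>h. - (h *\<^sub>C R w (R w x)))"
      by (intro bounded_linear_minus bounded_bilinear.bounded_linear_left[OF bounded_bilinear_scaleC])
  next
    fix z assume z: "z \<noteq> w" "dist z w < d"
    then have zD: "z \<in> D" using d by (auto simp: dist_commute subset_iff)
    have "R z x - R w x - - ((z - w) *\<^sub>C R w (R w x)) = (w - z) *\<^sub>C (R z (R w x) - R w (R w x))"
      unfolding resolvent_identity[OF zD w, of x]
      by (simp add: complex_vector.scale_right_diff_distrib complex_vector.scale_left_diff_distrib)
    then show "norm (R z x - R w x - - ((z - w) *\<^sub>C R w (R w x))) / norm (z - w)
        \<le> norm (R z (R w x) - R w (R w x))"
      using z(1) by (simp add: norm_scaleC norm_minus_commute)
  next
    have "isCont (\<lambda>z. R z (R w x)) w"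
      using continuous_on_R[of "\<lambda>_. R w x"] w continuous_on_eq_continuous_at[OF open_D] by auto
    then have "((\<lambda>z. norm (R z (R w x) - R w (R w x))) \<longlongrightarrow> norm (R w (R w x) - R w (R w x))) (at w)"
      unfolding isCont_def by (intro tendsto_intros)
    then show "((\<lambda>z. norm (R z (R w x) - R w (R w x))) \<longlongrightarrow> 0) (at w)" by simp
  qed
qed

end

text \<open>
  The two scalar means that enter the resolvent computations. On the circle the derivative of the
  parametrisation is \<open>2 \<pi> \<i>\<close> times the point itself, so a mean of \<open>g\<close> is the contour integral of
  \<open>g u / u\<close> divided by \<open>2 \<pi> \<i>\<close>, and Cauchy's formula evaluates it.
\<close>

lemma circlepath_mean_outer:
  assumes "cmod z < r"
  shows "((\<lambda>t. circlepath 0 r t / (circlepath 0 r t - z)) has_integral 1) {0..1}"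
proof -
  have "((\<lambda>u. 1 / (u - z)) has_contour_integral (2 * of_real pi * \<i> * 1)) (circlepath 0 r)"
    using assms by (intro Cauchy_integral_circlepath_simple[where f = "\<lambda>_. 1"]) auto
  then have "((\<lambda>t. 1 / (circlepath 0 r t - z) * (2 * pi * \<i> * r * exp (2 * of_real pi * \<i> * t)))
      has_integral (2 * of_real pi * \<i> * 1)) {0..1}"
    by (simp add: has_contour_integral vector_derivative_circlepath)
  from has_integral_mult_right[OF this, of "1 / (2 * of_real pi * \<i>)"]
  have "((\<lambda>t. 1 / (2 * of_real pi * \<i>) *
      (1 / (circlepath 0 r t - z) * (2 * pi * \<i> * r * exp (2 * of_real pi * \<i> * t))))
      has_integral 1) {0..1}" by simp
  moreover have "1 / (2 * of_real pi * \<i>) *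
      (1 / (circlepath 0 r t - z) * (2 * pi * \<i> * r * exp (2 * of_real pi * \<i> * t))) =
      circlepath 0 r t / (circlepath 0 r t - z)" for t
    by (simp add: circlepath)
  ultimately show ?thesis by (simp only:)
qed

lemma circlepath_mean_inner:
  assumes "0 < r" "r < cmod z"
  shows "((\<lambda>t. circlepath 0 r t / (z - circlepath 0 r t)) has_integral 0) {0..1}"
proof -
  have "((\<lambda>u. (u / (z - u)) / (u - 0)) has_contour_integral (2 * of_real pi * \<i> * (0 / (z - 0)))) (circlepath 0 r)"
    using assms by (intro Cauchy_integral_circlepath_simple holomorphic_intros) auto
  then have "((\<lambda>t. (circlepath 0 r t / (z - circlepath 0 r t)) / circlepath 0 r t *
      (2 * pi * \<i> * r * exp (2 * of_real pi * \<i> * t))) has_integral 0) {0..1}"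
    by (simp add: has_contour_integral vector_derivative_circlepath)
  from has_integral_mult_right[OF this, of "1 / (2 * of_real pi * \<i>)"]
  have "((\<lambda>t. 1 / (2 * of_real pi * \<i>) * ((circlepath 0 r t / (z - circlepath 0 r t)) /
      circlepath 0 r t * (2 * pi * \<i> * r * exp (2 * of_real pi * \<i> * t))))
      has_integral 0) {0..1}" by simp
  moreover have "1 / (2 * of_real pi * \<i>) * ((circlepath 0 r t / (z - circlepath 0 r t)) /
      circlepath 0 r t * (2 * pi * \<i> * r * exp (2 * of_real pi * \<i> * t))) =
      circlepath 0 r t / (z - circlepath 0 r t)" for t
    using assms(1) by (simp add: circlepath)
  ultimately show ?thesis by (simp only:)
qed

context punctured_resolvent
begin

definition circle_mean :: "(complex \<Rightarrow> complex) \<Rightarrow> real \<Rightarrow> 'a \<Rightarrow> 'a" where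
  "circle_mean k r x =
    integral {0..1} (\<lambda>t. k (circlepath 0 r t) *\<^sub>C R (circlepath 0 r t) x)"

lemma circlepath_in_sphere: "0 < r \<Longrightarrow> circlepath 0 r t \<in> sphere 0 r"
  by (simp add: circlepath norm_mult)

lemma sphere_subset_D: "0 < r \<Longrightarrow> r < \<rho> \<Longrightarrow> sphere 0 r \<subseteq> D"
  by (auto simp: D_def)

lemma continuous_on_circlepath: "continuous_on {0..1} (circlepath 0 r)"
  unfolding circlepath by (intro continuous_intros)

lemma continuous_on_circle_integrand:
  assumes r: "0 < r" "r < \<rho>" and k: "continuous_on (sphere 0 r) k"
  shows "continuous_on {0..1} (\<lambda>t. k (circlepath 0 r t) *\<^sub>C R (circlepath 0 r t) x)"
proof -
  have "continuous_on (sphere 0 r) (\<lambda>z. k z *\<^sub>C R z x)"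
    using continuous_on_R[of "\<lambda>_. x"] sphere_subset_D[OF r] k
    by (intro bounded_bilinear.continuous_on[OF bounded_bilinear_scaleC])
      (auto intro: continuous_on_subset)
  then show ?thesis
    using circlepath_in_sphere[OF r(1)]
    by (intro continuous_on_compose2[OF _ continuous_on_circlepath]) auto
qed

lemma has_integral_circle_mean:
  assumes "0 < r" "r < \<rho>" "continuous_on (sphere 0 r) k"
  shows "((\<lambda>t. k (circlepath 0 r t) *\<^sub>C R (circlepath 0 r t) x) has_integral circle_mean k r x) {0..1}"
  unfolding circle_mean_def
  using continuous_on_circle_integrand[OF assms] by (intro integrable_integral integrable_continuous_interval)

lemma norm_circle_mean_le:
  assumes r: "0 < r" "r < \<rho>" and k: "continuous_on (sphere 0 r) k"
    and B: "\<And>z. z \<in> sphere 0 r \<Longrightarrow> cmod (k z) * norm (R z x) \<le> B"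
  shows "norm (circle_mean k r x) \<le> B"
proof -
  have "norm (circle_mean k r x) \<le> B * (1 - 0)"
    unfolding circle_mean_def
    using B circlepath_in_sphere[OF r(1)]
    by (intro integral_bound continuous_on_circle_integrand[OF r k]) (auto simp: norm_scaleC)
  then show ?thesis by simp
qed

lemma circle_mean_commute:
  assumes r: "0 < r" "r < \<rho>" and k: "continuous_on (sphere 0 r) k"
    and U: "bounded_clinear U" "\<And>x. U (A x) = A (U x)"
  shows "U (circle_mean k r x) = circle_mean k r (U x)"
proof -
  have Ulin: "bounded_linear U" and Uscale: "\<And>c x. U (c *\<^sub>C x) = c *\<^sub>C U x"
    using U(1) by (simp_all add: bounded_clinear_iff)
  have "(U \<circ> (\<lambda>t. k (circlepath 0 r t) *\<^sub>C R (circlepath 0 r t) x) has_integral U (circle_mean k r x)) {0..1}"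
    using has_integral_circle_mean[OF r k] Ulin by (rule has_integral_linear)
  also have "U \<circ> (\<lambda>t. k (circlepath 0 r t) *\<^sub>C R (circlepath 0 r t) x) =
      (\<lambda>t. k (circlepath 0 r t) *\<^sub>C R (circlepath 0 r t) (U x))"
    using circlepath_in_sphere[OF r(1)] sphere_subset_D[OF r] R_commute[OF _ U] Uscale
    by (simp add: fun_eq_iff subset_iff)
  finally show ?thesis
    using has_integral_circle_mean[OF r k] has_integral_unique by blast
qed

lemma bounded_clinear_circle_mean:
  assumes r: "0 < r" "r < \<rho>" and k: "continuous_on (sphere 0 r) k"
  shows "bounded_clinear (circle_mean k r)"
proof -
  have on: "circlepath 0 r t \<in> D" for t
    using circlepath_in_sphere[OF r(1)] sphere_subset_D[OF r] by blast
  have add: "circle_mean k r (x + y) = circle_mean k r x + circle_mean k r y" for x y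
    using has_integral_add[OF has_integral_circle_mean[OF r k, of x] has_integral_circle_mean[OF r k, of y]]
    by (intro has_integral_unique[OF has_integral_circle_mean[OF r k]])
      (simp add: R_add[OF on] scaleC_add_right)
  have scale: "circle_mean k r (c *\<^sub>C x) = c *\<^sub>C circle_mean k r x" for c x
  proof (rule circle_mean_commute[OF r k, symmetric])
    show "bounded_clinear ((*\<^sub>C) c :: 'a \<Rightarrow> 'a)"
      using bounded_bilinear.bounded_linear_right[OF bounded_bilinear_scaleC]
      by (simp add: bounded_clinear_iff scaleC_scaleC mult.commute)
  qed (simp add: A_scale)
  obtain K where K: "0 \<le> K" "\<And>z v. z \<in> sphere 0 r \<Longrightarrow> norm (R z v) \<le> K * norm v"
    using R_bounded_on_compact[OF compact_sphere sphere_subset_D[OF r]] by blast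
  obtain L where L: "\<And>z. z \<in> sphere 0 r \<Longrightarrow> cmod (k z) \<le> L"
    using compact_imp_bounded[OF compact_continuous_image[OF k compact_sphere]]
    unfolding bounded_iff by blast
  have "norm (circle_mean k r x) \<le> norm x * (L * K)" for x
  proof (rule norm_circle_mean_le[OF r k])
    fix z assume z: "z \<in> sphere (0::complex) r"
    have "cmod (k z) * norm (R z x) \<le> L * (K * norm x)"
      using L[OF z] K(2)[OF z, of x] order_trans[OF norm_ge_zero L[OF z]] by (intro mult_mono) auto
    then show "cmod (k z) * norm (R z x) \<le> norm x * (L * K)" by (simp add: mult_ac)
  qed
  then have "bounded_linear (circle_mean k r)"
    by (intro bounded_linear_intro[where K = "L * K"]) (simp_all add: add scale scaleR_scaleC)
  then show ?thesis by (simp add: bounded_clinear_iff scale)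
qed

abbreviation riesz :: "real \<Rightarrow> 'a \<Rightarrow> 'a" where
  "riesz \<equiv> circle_mean (\<lambda>z. z)"

text \<open>
  In logarithmic coordinates \<open>z = exp (u + 2 \<pi> \<i> t)\<close> the derivative of \<open>z R z x\<close> in \<open>t\<close> is
  \<open>2 \<pi> \<i>\<close> times its derivative in \<open>u\<close>. The former integrates to \<open>0\<close> over a period, so the mean over
  \<open>t\<close> has zero derivative in \<open>u\<close>.
\<close>

lemma riesz_radius_independent:
  assumes r: "0 < r" "r < \<rho>" and s: "0 < s" "s < \<rho>"
  shows "riesz r x = riesz s x"
proof -
  define e where "e u t = exp (of_real u + 2 * of_real pi * \<i> * of_real t)" for u t :: real
  define U where "U = {..<ln \<rho>}"
  define G where "G z = R z x - z *\<^sub>C R z (R z x)" for z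
  have eD: "e u t \<in> D" if "u \<in> U" for u t
  proof -
    have "exp u < \<rho>" using that rho unfolding U_def by (metis exp_less_cancel_iff exp_ln lessThan_iff)
    then show ?thesis by (simp add: e_def D_def)
  qed
  have cont_R: "continuous_on D (\<lambda>z. R z x)"
    by (rule continuous_on_R) (intro continuous_intros)
  have cont_G: "continuous_on D G"
    unfolding G_def
    by (intro continuous_intros bounded_bilinear.continuous_on[OF bounded_bilinear_scaleC]
        continuous_on_R cont_R)
  have deriv: "((\<lambda>z. z *\<^sub>C R z x) has_derivative (\<lambda>h. h *\<^sub>C G z)) (at z)" if "z \<in> D" for z
    by (rule has_derivative_eq_rhs[OF bounded_bilinear.FDERIV[OF bounded_bilinear_scaleC
          has_derivative_ident R_has_derivative[OF that]]])
      (simp add: G_def fun_eq_iff complex_vector.scale_right_diff_distrib scaleC_scaleC mult.commute)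
  have e_u: "((\<lambda>u. e u t) has_vector_derivative e u t) (at u within S)" for u t S
  proof -
    have "((\<lambda>u. e u t) has_vector_derivative 1 * e u t) (at u within S)"
      unfolding e_def
      by (intro field_vector_diff_chain_within[unfolded o_def] derivative_eq_intros) auto
    then show ?thesis by simp
  qed
  have e_t: "((\<lambda>t. e u t) has_vector_derivative 2 * of_real pi * \<i> * e u t) (at t within S)" for u t S
    unfolding e_def
    by (intro field_vector_diff_chain_within[unfolded o_def] derivative_eq_intros) auto
  have chain: "((\<lambda>t. c t *\<^sub>C R (c t) x) has_vector_derivative c' *\<^sub>C G (c t)) (at t within S)"
    if "(c has_vector_derivative c') (at t within S)" "c t \<in> D" for c c' t S
    using vector_derivative_diff_chain_within[OF that(1) has_derivative_at_withinI[OF deriv[OF that(2)]]]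
    by (simp add: o_def)
  have cont_e: "continuous_on S (\<lambda>(u, t). e u t)" for S
    unfolding e_def split_beta by (intro continuous_intros)
  have cont: "continuous_on (U \<times> cbox 0 1) (\<lambda>(u, t). e u t *\<^sub>C G (e u t))"
  proof -
    have "continuous_on (U \<times> cbox 0 1) (\<lambda>p. (case p of (u, t) \<Rightarrow> e u t) *\<^sub>C G (case p of (u, t) \<Rightarrow> e u t))"
      using eD by (intro bounded_bilinear.continuous_on[OF bounded_bilinear_scaleC] cont_e
          continuous_on_compose2[OF cont_G cont_e]) auto
    then show ?thesis by (simp add: split_beta)
  qed
  define F where "F u = integral (cbox 0 1) (\<lambda>t. e u t *\<^sub>C R (e u t) x)" for u
  have cont_slice: "continuous_on {0..1} (\<lambda>t. e u t)" for u
    unfolding e_def by (intro continuous_intros)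
  have zero: "integral (cbox 0 1) (\<lambda>t. e u t *\<^sub>C G (e u t)) = 0" if u: "u \<in> U" for u
  proof -
    have int: "(\<lambda>t. e u t *\<^sub>C G (e u t)) integrable_on {0..1}"
      by (intro integrable_continuous_interval bounded_bilinear.continuous_on[OF bounded_bilinear_scaleC]
          cont_slice continuous_on_compose2[OF cont_G cont_slice] image_subsetI eD[OF u])
    have "((\<lambda>t. (2 * of_real pi * \<i> * e u t) *\<^sub>C G (e u t)) has_integral
        (e u 1 *\<^sub>C R (e u 1) x - e u 0 *\<^sub>C R (e u 0) x)) {0..1}"
      by (rule fundamental_theorem_of_calculus) (use eD[OF u] e_t chain in auto)
    moreover have "e u 1 = e u 0"
      by (simp add: e_def exp_add exp_two_pi_i)
    ultimately have "((\<lambda>t. (2 * of_real pi * \<i> * e u t) *\<^sub>C G (e u t)) has_integral 0) {0..1}" by simp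
    moreover have "((\<lambda>t. (2 * of_real pi * \<i>) *\<^sub>C (e u t *\<^sub>C G (e u t))) has_integral
        (2 * of_real pi * \<i>) *\<^sub>C integral {0..1} (\<lambda>t. e u t *\<^sub>C G (e u t))) {0..1}"
      using has_integral_linear[OF integrable_integral[OF int]
          bounded_bilinear.bounded_linear_right[OF bounded_bilinear_scaleC]] by (simp add: o_def)
    ultimately have "(2 * of_real pi * \<i>) *\<^sub>C integral {0..1} (\<lambda>t. e u t *\<^sub>C G (e u t)) = 0"
      unfolding scaleC_scaleC by (metis has_integral_unique)
    then show ?thesis by simp
  qed
  have "(F has_vector_derivative 0) (at u within U)" if u: "u \<in> U" for u
  proof -
    have "(F has_vector_derivative integral (cbox 0 1) (\<lambda>t. e u t *\<^sub>C G (e u t))) (at u within U)"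
      unfolding F_def
    proof (rule leibniz_rule_vector_derivative[OF _ _ cont u])
      show "((\<lambda>u. e u t *\<^sub>C R (e u t) x) has_vector_derivative e u t *\<^sub>C G (e u t)) (at u within U)"
        if "u \<in> U" for u t using chain[OF e_u eD[OF that]] .
      show "(\<lambda>t. e u t *\<^sub>C R (e u t) x) integrable_on cbox 0 1" if "u \<in> U" for u
        unfolding cbox_interval
        by (intro integrable_continuous_interval bounded_bilinear.continuous_on[OF bounded_bilinear_scaleC]
          cont_slice continuous_on_compose2[OF cont_R cont_slice] image_subsetI eD[OF that])
      show "convex U" by (simp add: U_def)
    qed
    then show ?thesis using zero[OF u] by simp
  qed
  then obtain c where c: "\<And>u. u \<in> U \<Longrightarrow> F u = c"
    using has_vector_derivative_zero_constant[of U F] by (auto simp: U_def)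
  have "riesz r x = F (ln r)" if "0 < r" for r
    using that unfolding circle_mean_def F_def e_def circlepath cbox_interval
    by (simp add: exp_add exp_of_real)
  moreover have "ln r \<in> U" "ln s \<in> U" using r s by (auto simp: U_def)
  ultimately show ?thesis using c r s by simp
qed

text \<open>
  The right-hand side stays bounded as \<open>z\<close> approaches \<open>0\<close>: on the range of \<open>1 - riesz s\<close> the
  singularity of the resolvent is removed. The formula is the resolvent identity, multiplied by
  \<open>w / (w - z)\<close> and averaged over the circle.
\<close>

lemma resolvent_complement:
  assumes s: "0 < s" "s < \<rho>" and z: "0 < cmod z" "cmod z < s"
  shows "R z (x - riesz s x) = circle_mean (\<lambda>w. w / (w - z)) s x"
proof -
  have zD: "z \<in> D" using z s by (simp add: D_def)
  have wD: "circlepath 0 s t \<in> D" for t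
    using circlepath_in_sphere[OF s(1)] sphere_subset_D[OF s] by blast
  have ne: "circlepath 0 s t \<noteq> z" for t
    using circlepath_in_sphere[OF s(1), of t] z by auto
  have k: "continuous_on (sphere 0 s) (\<lambda>w. w / (w - z))"
    using z by (intro continuous_intros) auto
  have "((\<lambda>t. (circlepath 0 s t / (circlepath 0 s t - z)) *\<^sub>C R z x) has_integral 1 *\<^sub>C R z x) {0..1}"
    using has_integral_linear[OF circlepath_mean_outer[OF z(2)]
        bounded_bilinear.bounded_linear_left[OF bounded_bilinear_scaleC]] by (simp add: o_def)
  moreover have "((\<lambda>t. R z (circlepath 0 s t *\<^sub>C R (circlepath 0 s t) x)) has_integral R z (riesz s x)) {0..1}"
    using has_integral_linear[OF has_integral_circle_mean[OF s, of "\<lambda>z. z"] R_linear[OF zD]]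
    by (simp add: o_def continuous_on_id)
  ultimately have "((\<lambda>t. (circlepath 0 s t / (circlepath 0 s t - z)) *\<^sub>C R z x -
      R z (circlepath 0 s t *\<^sub>C R (circlepath 0 s t) x)) has_integral 1 *\<^sub>C R z x - R z (riesz s x)) {0..1}"
    by (rule has_integral_diff)
  moreover have "(w / (w - z)) *\<^sub>C R z x - R z (w *\<^sub>C R w x) = (w / (w - z)) *\<^sub>C R w x"
    if w: "w \<in> D" "w \<noteq> z" for w
  proof -
    have "(w / (w - z)) *\<^sub>C (R z x - R w x) = w *\<^sub>C R z (R w x)"
      unfolding resolvent_identity[OF zD w(1), of x] scaleC_scaleC using w(2) by simp
    then show ?thesis
      by (simp add: R_scale[OF zD] complex_vector.scale_right_diff_distrib algebra_simps)
  qed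
  ultimately have "((\<lambda>t. (circlepath 0 s t / (circlepath 0 s t - z)) *\<^sub>C R (circlepath 0 s t) x)
      has_integral 1 *\<^sub>C R z x - R z (riesz s x)) {0..1}"
    using wD ne by simp
  then have "1 *\<^sub>C R z x - R z (riesz s x) = circle_mean (\<lambda>w. w / (w - z)) s x"
    using has_integral_circle_mean[OF s k] has_integral_unique by blast
  then show ?thesis by (simp add: R_diff[OF zD] scaleC_one)
qed

text \<open>
  On \<open>y = x - riesz s x\<close> the resolvent is bounded near \<open>0\<close>, so the mean of \<open>z R z y\<close> over the circle
  of radius \<open>r\<close> is of order \<open>r\<close>. It does not depend on \<open>r\<close>, hence it vanishes.
\<close>

lemma riesz_idempotent:
  assumes s: "0 < s" "s < \<rho>"
  shows "riesz s (riesz s x) = riesz s x"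
proof -
  obtain K where K: "0 \<le> K" "\<And>z v. z \<in> sphere 0 s \<Longrightarrow> norm (R z v) \<le> K * norm v"
    using R_bounded_on_compact[OF compact_sphere sphere_subset_D[OF s]] by blast
  define y where "y = x - riesz s x"
  have bound: "norm (R z y) \<le> 2 * K * norm x" if z: "0 < cmod z" "cmod z \<le> s / 2" for z
  proof -
    have "cmod z < s" using z s by simp
    have "norm (circle_mean (\<lambda>w. w / (w - z)) s x) \<le> 2 * K * norm x"
    proof (rule norm_circle_mean_le[OF s])
      show "continuous_on (sphere 0 s) (\<lambda>w. w / (w - z))"
        using \<open>cmod z < s\<close> by (intro continuous_intros) auto
      fix w assume w: "w \<in> sphere (0::complex) s"
      have "s / 2 \<le> cmod (w - z)" using norm_triangle_ineq2[of w z] w z by simp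
      then have "cmod (w / (w - z)) \<le> 2"
        using w s by (simp add: norm_divide divide_le_eq)
      then have "cmod (w / (w - z)) * norm (R w x) \<le> 2 * (K * norm x)"
        using K(2)[OF w, of x] by (intro mult_mono) auto
      then show "cmod (w / (w - z)) * norm (R w x) \<le> 2 * K * norm x" by simp
    qed
    then show ?thesis
      unfolding y_def using resolvent_complement[OF s z(1) \<open>cmod z < s\<close>] by simp
  qed
  have small: "norm (riesz s y) \<le> r * (2 * K * norm x)" if r: "0 < r" "r \<le> s / 2" for r
  proof -
    have r': "r < \<rho>" using r s by simp
    have "norm (riesz r y) \<le> r * (2 * K * norm x)"
      using r bound
      by (intro norm_circle_mean_le[OF r(1) r'] continuous_on_id mult_mono) auto
    then show ?thesis using riesz_radius_independent[OF r(1) r' s] by simp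
  qed
  have "norm (riesz s y) \<le> 0"
  proof (rule tendsto_lowerbound[where F = "at_right 0"])
    have "((\<lambda>r. r * (2 * K * norm x)) \<longlongrightarrow> 0 * (2 * K * norm x)) (at_right 0)"
      by (intro tendsto_intros)
    then show "((\<lambda>r. r * (2 * K * norm x)) \<longlongrightarrow> 0) (at_right 0)" by simp
    show "\<forall>\<^sub>F r in at_right 0. norm (riesz s y) \<le> r * (2 * K * norm x)"
      using s by (intro eventually_at_rightI[of 0 "s/2"] small) auto
  qed simp
  moreover have "riesz s y = riesz s x - riesz s (riesz s x)"
    unfolding y_def using bounded_clinear_circle_mean[OF s continuous_on_id]
    by (simp add: bounded_clinear_iff linear_diff bounded_linear.linear)
  ultimately show ?thesis by simp
qed

text \<open>
  The constant weight gives, up to sign, an inverse of \<open>A\<close> on the kernel of the projection, because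
  \<open>A R z = z R z - 1\<close>.
\<close>

lemma riesz_regular_part:
  assumes s: "0 < s" "s < \<rho>"
  shows "A (circle_mean (\<lambda>_. 1) s x) = riesz s x - x"
proof -
  have wD: "circlepath 0 s t \<in> D" for t
    using circlepath_in_sphere[OF s(1)] sphere_subset_D[OF s] by blast
  have "((\<lambda>t. A (1 *\<^sub>C R (circlepath 0 s t) x)) has_integral A (circle_mean (\<lambda>_. 1) s x)) {0..1}"
    using has_integral_linear[OF has_integral_circle_mean[OF s continuous_on_const, of 1 x] A_linear]
    by (simp add: o_def)
  moreover have "A (1 *\<^sub>C R w x) = w *\<^sub>C R w x - x" if "w \<in> D" for w
    using R_right'[OF that, of x] by (simp add: scaleC_one algebra_simps)
  ultimately have "((\<lambda>t. circlepath 0 s t *\<^sub>C R (circlepath 0 s t) x - x) has_integral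
      A (circle_mean (\<lambda>_. 1) s x)) {0..1}"
    using wD by simp
  moreover have "((\<lambda>t. circlepath 0 s t *\<^sub>C R (circlepath 0 s t) x - x) has_integral riesz s x - x) {0..1}"
    using has_integral_diff[OF has_integral_circle_mean[OF s continuous_on_id] has_integral_const_real[of x 0 1]]
    by simp
  ultimately show ?thesis by (rule has_integral_unique)
qed

text \<open>
  Outside the circle, \<open>z - A\<close> has an inverse on the range of the projection: since
  \<open>(z - A) R w = 1 + (z - w) R w\<close>, the weight \<open>w / (z - w)\<close> produces the projection and a multiple of
  the identity, whose coefficient is a mean that vanishes.
\<close>

lemma riesz_singular_part:
  assumes r: "0 < r" "r < \<rho>" and z: "r < cmod z"
  defines "V \<equiv> circle_mean (\<lambda>w. w / (z - w)) r"
  shows "z *\<^sub>C V x - A (V x) = riesz r x"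
proof -
  have wD: "circlepath 0 r t \<in> D" for t
    using circlepath_in_sphere[OF r(1)] sphere_subset_D[OF r] by blast
  have ne: "circlepath 0 r t \<noteq> z" for t
    using circlepath_in_sphere[OF r(1), of t] z by auto
  have k: "continuous_on (sphere 0 r) (\<lambda>w. w / (z - w))"
    using z by (intro continuous_intros) auto
  have shift: "bounded_linear (\<lambda>x. z *\<^sub>C x - A x)"
    by (intro bounded_linear_sub A_linear bounded_bilinear.bounded_linear_right[OF bounded_bilinear_scaleC])
  have "((\<lambda>t. (circlepath 0 r t / (z - circlepath 0 r t)) *\<^sub>C x) has_integral 0 *\<^sub>C x) {0..1}"
    using has_integral_linear[OF circlepath_mean_inner[OF r(1) z]
        bounded_bilinear.bounded_linear_left[OF bounded_bilinear_scaleC]] by (simp add: o_def)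
  from has_integral_add[OF this has_integral_circle_mean[OF r continuous_on_id]]
  have "((\<lambda>t. (circlepath 0 r t / (z - circlepath 0 r t)) *\<^sub>C x +
      circlepath 0 r t *\<^sub>C R (circlepath 0 r t) x) has_integral riesz r x) {0..1}" by simp
  moreover have "(w / (z - w)) *\<^sub>C x + w *\<^sub>C R w x =
      z *\<^sub>C ((w / (z - w)) *\<^sub>C R w x) - A ((w / (z - w)) *\<^sub>C R w x)"
    if w: "w \<in> D" "w \<noteq> z" for w
  proof -
    have "z *\<^sub>C R w x - A (R w x) = x + (z - w) *\<^sub>C R w x"
      using R_right'[OF w(1), of x] by (simp add: complex_vector.scale_left_diff_distrib algebra_simps)
    then have "(w / (z - w)) *\<^sub>C (z *\<^sub>C R w x - A (R w x)) = (w / (z - w)) *\<^sub>C x + w *\<^sub>C R w x"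
      using w(2) by (simp add: scaleC_add_right scaleC_scaleC)
    then show ?thesis
      by (simp add: A_scale complex_vector.scale_right_diff_distrib scaleC_scaleC mult.commute)
  qed
  ultimately have "((\<lambda>t. z *\<^sub>C ((circlepath 0 r t / (z - circlepath 0 r t)) *\<^sub>C R (circlepath 0 r t) x) -
      A ((circlepath 0 r t / (z - circlepath 0 r t)) *\<^sub>C R (circlepath 0 r t) x)) has_integral riesz r x) {0..1}"
    using wD ne by simp
  moreover have "((\<lambda>t. z *\<^sub>C ((circlepath 0 r t / (z - circlepath 0 r t)) *\<^sub>C R (circlepath 0 r t) x) -
      A ((circlepath 0 r t / (z - circlepath 0 r t)) *\<^sub>C R (circlepath 0 r t) x)) has_integral
      (z *\<^sub>C V x - A (V x))) {0..1}"
    using has_integral_linear[OF has_integral_circle_mean[OF r k] shift] by (simp add: o_def V_def)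
  ultimately show ?thesis by (rule has_integral_unique[rotated])
qed

lemma riesz_complement_inverse:
  assumes s: "0 < s" "s < \<rho>"
  shows "\<exists>S. bounded_clinear S \<and> (\<forall>x. A (S x) = x - riesz s x \<and> S (A x) = x - riesz s x)"
proof -
  define S where "S x = - circle_mean (\<lambda>_. 1) s x" for x
  have S: "bounded_clinear S"
    using bounded_clinear_circle_mean[OF s continuous_on_const, of 1]
    by (simp add: S_def[abs_def] bounded_clinear_iff bounded_linear_minus)
  have S_commute: "S (A x) = A (S x)" for x
    using circle_mean_commute[OF s continuous_on_const A, of 1 x] A_linear
    by (simp add: S_def linear_neg bounded_linear.linear)
  have AS: "A (S x) = x - riesz s x" for x
    using riesz_regular_part[OF s, of x] A_linear
    by (simp add: S_def linear_neg bounded_linear.linear)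
  have "S (A x) = x - riesz s x" for x by (simp add: S_commute AS)
  with S AS show ?thesis by blast
qed

text \<open>
  Only \<open>0\<close> remains in the spectrum on the range: each \<open>z\<close> other than \<open>0\<close> lies outside a smaller
  circle, and the projection is the same for that circle.
\<close>

lemma riesz_range_resolvent:
  assumes s: "0 < s" "s < \<rho>" and z: "z \<noteq> 0"
  shows "\<exists>V. bounded_clinear V \<and>
    (\<forall>x. A (V x) - z *\<^sub>C V x = riesz s x \<and> V (A x - z *\<^sub>C x) = riesz s x)"
proof -
  define r where "r = min (cmod z) \<rho> / 2"
  have "0 < cmod z" using z by simp
  then have r: "0 < r" "r < \<rho>" "r < cmod z" using rho unfolding r_def by linarith+
  define V where "V x = - circle_mean (\<lambda>w. w / (z - w)) r x" for x
  have k: "continuous_on (sphere 0 r) (\<lambda>w. w / (z - w))"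
    using r by (intro continuous_intros) auto
  have V: "bounded_clinear V"
    using bounded_clinear_circle_mean[OF r(1,2) k]
    by (simp add: V_def[abs_def] bounded_clinear_iff bounded_linear_minus)
  have V_commute: "V (A x) = A (V x)" for x
    using circle_mean_commute[OF r(1,2) k A, of x] A_linear
    by (simp add: V_def linear_neg bounded_linear.linear)
  have AV: "A (V x) - z *\<^sub>C V x = riesz s x" for x
    using riesz_singular_part[OF r, of x] riesz_radius_independent[OF r(1,2) s] A_linear
    by (simp add: V_def linear_neg bounded_linear.linear)
  have "V (A x - z *\<^sub>C x) = riesz s x" for x
    using AV[of x] V by (simp add: bounded_clinear_iff linear_diff bounded_linear.linear V_commute)
  with V AV show ?thesis by blast
qed

end

section \<open>Splitting off an isolated spectral point of a direct summand\<close>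

lemma bounded_clinear_simps:
  assumes "bounded_clinear T"
  shows "T (x + y) = T x + T y" "T (x - y) = T x - T y" "T (- x) = - T x" "T 0 = 0"
    "T (c *\<^sub>C x) = c *\<^sub>C T x" "bounded_linear T"
  using assms
  by (simp_all add: bounded_clinear_iff linear_add linear_diff linear_neg linear_0 bounded_linear.linear)

text \<open>
  Addition maps the Banach space \<open>M \<times> N\<close> onto the whole space, so the open mapping theorem bounds
  the components of a vector by the vector.
\<close>

lemma bounded_projection_of_direct_sum:
  fixes M N :: "'a::complex_banach set"
  assumes M: "complex_vector.subspace M" "closed M" and N: "complex_vector.subspace N" "closed N"
    and inter: "M \<inter> N = {0}" and sum: "{x + y | x y. x \<in> M \<and> y \<in> N} = UNIV"
  shows "\<exists>Q. bounded_clinear Q \<and> (\<forall>x. Q x \<in> N \<and> x - Q x \<in> M) \<and> (\<forall>x\<in>M. \<forall>y\<in>N. Q (x + y) = y)"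
proof -
  define T where "T p = fst p + snd p" for p :: "'a \<times> 'a"
  have T: "bounded_linear T"
    unfolding T_def by (intro bounded_linear_add bounded_linear_fst bounded_linear_snd)
  have MN: "subspace (M \<times> N)" "closed (M \<times> N)"
    using M N by (auto intro: subspace_Times subspace_of_complex_subspace closed_Times)
  have onto: "T ` (M \<times> N) = UNIV"
  proof -
    have "v \<in> T ` (M \<times> N)" for v
    proof -
      have "v \<in> {x + y | x y. x \<in> M \<and> y \<in> N}" using sum by simp
      then obtain x y where "v = x + y" "x \<in> M" "y \<in> N" by blast
      then show ?thesis by (intro image_eqI[of _ _ "(x, y)"]) (auto simp: T_def)
    qed
    then show ?thesis by blast
  qed
  obtain C where C: "\<And>v. \<exists>p\<in>M \<times> N. norm p \<le> C * norm v \<and> T p = v"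
    using open_mapping[OF T MN] onto by auto
  have ex: "\<exists>y. y \<in> N \<and> v - y \<in> M \<and> norm y \<le> norm v * C" for v
  proof -
    obtain p where p: "p \<in> M \<times> N" "norm p \<le> C * norm v" "T p = v" using C by blast
    have "norm (snd p) \<le> norm p" by (metis norm_snd_le prod.collapse)
    moreover have "v - snd p = fst p" using p(3) by (auto simp: T_def)
    ultimately show ?thesis using p by (intro exI[of _ "snd p"]) (auto simp: mult.commute)
  qed
  then obtain Q where Q: "\<And>v. Q v \<in> N" "\<And>v. v - Q v \<in> M" "\<And>v. norm (Q v) \<le> norm v * C"
    by metis
  have unique: "Q v = y" if "y \<in> N" "v - y \<in> M" for v y
  proof -
    have "(v - y) - (v - Q v) \<in> M" by (intro complex_vector.subspace_diff[OF M(1)] that Q)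
    then have "Q v - y \<in> M" by simp
    moreover have "Q v - y \<in> N" by (intro complex_vector.subspace_diff[OF N(1)] that Q)
    ultimately have "Q v - y = 0" using inter by blast
    then show ?thesis by simp
  qed
  have add: "Q (x + y) = Q x + Q y" for x y
  proof (rule unique)
    have "(x - Q x) + (y - Q y) \<in> M" by (intro complex_vector.subspace_add[OF M(1)] Q)
    then show "x + y - (Q x + Q y) \<in> M" by (simp add: algebra_simps)
  qed (intro complex_vector.subspace_add[OF N(1)] Q)
  have scale: "Q (c *\<^sub>C x) = c *\<^sub>C Q x" for c x
  proof (rule unique)
    have "c *\<^sub>C (x - Q x) \<in> M" by (intro complex_vector.subspace_scale[OF M(1)] Q)
    then show "c *\<^sub>C x - c *\<^sub>C Q x \<in> M" by (simp add: complex_vector.scale_right_diff_distrib)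
  qed (intro complex_vector.subspace_scale[OF N(1)] Q)
  have "bounded_clinear Q"
    using add scale Q(3) by (auto simp: bounded_clinear_on_def)
  moreover have "Q (x + y) = y" if "x \<in> M" "y \<in> N" for x y
    using that by (intro unique) auto
  ultimately show ?thesis using Q by blast
qed

text \<open>
  The Riesz projection of the restriction of \<open>A\<close> to the range of \<open>Q\<close>, as an operator on the whole
  space. The restriction is first extended by the identity on the kernel of \<open>Q\<close>. This adds only the
  point \<open>1\<close> to the spectrum, so inside the unit circle nothing changes, and the projection for the
  extension has its range inside the range of \<open>Q\<close>.
\<close>

lemma isolated_point_projection:
  fixes A Q :: "'a::complex_banach \<Rightarrow> 'a"
  assumes A: "bounded_clinear A" and Q: "bounded_clinear Q" "\<And>x. Q (Q x) = Q x"
    and AQ: "\<And>x. A (Q x) = Q (A x)" and rho: "0 < \<rho>"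
    and inv: "\<And>z. 0 < cmod z \<Longrightarrow> cmod z < \<rho> \<Longrightarrow> invertible_on (range Q) (\<lambda>x. A x - z *\<^sub>C x)"
  obtains P where "bounded_clinear P" "\<And>x. P (P x) = P x" "\<And>x. Q (P x) = P x"
    "\<And>x. P (Q x) = P x" "\<And>x. A (P x) = P (A x)"
    "\<And>y. Q y = y \<Longrightarrow> P y = 0 \<Longrightarrow> \<exists>x. Q x = x \<and> P x = 0 \<and> A x = y"
    "\<And>x. Q x = x \<Longrightarrow> P x = 0 \<Longrightarrow> A x = 0 \<Longrightarrow> x = 0"
    "\<And>z. z \<noteq> 0 \<Longrightarrow> invertible_on (range P) (\<lambda>x. A x - z *\<^sub>C x)"
proof -
  note As = bounded_clinear_simps[OF A] and Qs = bounded_clinear_simps[OF Q(1)]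
  define d where "d = min \<rho> 1"
  have "\<exists>S. bounded_clinear_on (range Q) S \<and>
      (\<forall>x\<in>range Q. S (A x - z *\<^sub>C x) = x \<and> A (S x) - z *\<^sub>C S x = x)"
    if "0 < cmod z" "cmod z < d" for z
    using inv[of z] that by (auto simp: d_def invertible_on_def)
  then obtain S where S: "\<And>z. 0 < cmod z \<Longrightarrow> cmod z < d \<Longrightarrow> bounded_clinear_on (range Q) (S z)"
    and SA: "\<And>z x. 0 < cmod z \<Longrightarrow> cmod z < d \<Longrightarrow> S z (A (Q x) - z *\<^sub>C Q x) = Q x"
    and AS: "\<And>z x. 0 < cmod z \<Longrightarrow> cmod z < d \<Longrightarrow> A (S z (Q x)) - z *\<^sub>C S z (Q x) = Q x"
    by (metis rangeI)
  define B where "B x = A (Q x) + (x - Q x)" for x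
  define R where "R z x = (1 / (z - 1)) *\<^sub>C (x - Q x) - S z (Q x)" for z x
  have B: "bounded_clinear B"
    unfolding bounded_clinear_iff B_def
    by (intro conjI bounded_linear_add bounded_linear_sub bounded_linear_ident Qs(6)
        bounded_linear_compose[OF As(6) Qs(6)] allI)
      (simp add: As Qs scaleC_add_right complex_vector.scale_right_diff_distrib)
  have QB: "Q (B x) = A (Q x)" for x by (simp add: B_def Qs Q(2) AQ[symmetric])
  interpret B: punctured_resolvent B R d
  proof
    show "bounded_clinear B" by (rule B)
    show "0 < d" using rho by (simp add: d_def)
  next
    fix z :: complex assume z: "0 < cmod z" "cmod z < d"
    have z1: "z \<noteq> 1" using z by (auto simp: d_def)
    have Sin: "S z (Q x) \<in> range Q" for x using S[OF z] by (auto simp: bounded_clinear_on_def)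
    then have QS: "Q (S z (Q x)) = S z (Q x)" for x using Q(2) by (metis rangeE)
    obtain K where K: "\<And>x. x \<in> range Q \<Longrightarrow> norm (S z x) \<le> norm x * K"
      using S[OF z] unfolding bounded_clinear_on_def by blast
    obtain L where L: "0 \<le> L" "\<And>x. norm (Q x) \<le> norm x * L"
      using bounded_linear.nonneg_bounded[OF Qs(6)] by blast
    have Sscale: "S z (c *\<^sub>C Q x) = c *\<^sub>C S z (Q x)" for c x
      using S[OF z] by (auto simp: bounded_clinear_on_def)
    have "bounded_linear (\<lambda>x. S z (Q x))"
    proof (rule bounded_linear_intro[where K = "L * \<bar>K\<bar>"])
      show "S z (Q (x + y)) = S z (Q x) + S z (Q y)" for x y
        using S[OF z] by (auto simp: bounded_clinear_on_def Qs)
      show "S z (Q (r *\<^sub>R x)) = r *\<^sub>R S z (Q x)" for r x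
        by (simp add: scaleR_scaleC Qs Sscale)
      show "norm (S z (Q x)) \<le> norm x * (L * \<bar>K\<bar>)" for x
      proof -
        have "norm (S z (Q x)) \<le> norm (Q x) * K" using K by blast
        also have "\<dots> \<le> norm (Q x) * \<bar>K\<bar>" by (intro mult_left_mono) auto
        also have "\<dots> \<le> norm x * L * \<bar>K\<bar>" using L(2) by (intro mult_right_mono) auto
        finally show ?thesis by (simp add: mult.assoc)
      qed
    qed
    then have "bounded_linear (R z)"
      unfolding R_def
      by (intro bounded_linear_sub bounded_linear_ident Qs(6)
          bounded_linear_compose[OF bounded_bilinear.bounded_linear_right[OF bounded_bilinear_scaleC]])
    moreover have "R z (c *\<^sub>C x) = c *\<^sub>C R z x" for c x
      by (simp add: R_def Qs Sscale complex_vector.scale_right_diff_distrib scaleC_scaleC mult.commute)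
    ultimately show "bounded_clinear (R z)" by (simp add: bounded_clinear_iff)
    show "R z (z *\<^sub>C x - B x) = x" for x
    proof -
      have Qu: "Q (z *\<^sub>C x - B x) = (-1) *\<^sub>C (A (Q x) - z *\<^sub>C Q x)" by (simp add: Qs QB)
      have "A (Q x) - z *\<^sub>C Q x = Q (A x - z *\<^sub>C x)" by (simp add: Qs AQ)
      then have "S z (Q (z *\<^sub>C x - B x)) = (-1) *\<^sub>C S z (A (Q x) - z *\<^sub>C Q x)"
        unfolding Qu using Sscale by metis
      also have "\<dots> = - Q x" by (simp add: SA[OF z])
      finally have 1: "S z (Q (z *\<^sub>C x - B x)) = - Q x" .
      have "(z *\<^sub>C x - B x) - Q (z *\<^sub>C x - B x) = (z - 1) *\<^sub>C (x - Q x)"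
        by (simp add: Qs QB) (simp add: B_def complex_vector.scale_right_diff_distrib
            complex_vector.scale_left_diff_distrib)
      then have "(1 / (z - 1)) *\<^sub>C ((z *\<^sub>C x - B x) - Q (z *\<^sub>C x - B x)) = x - Q x"
        using z1 by (simp add: scaleC_scaleC)
      then show ?thesis unfolding R_def 1 by simp
    qed
    show "z *\<^sub>C R z x - B (R z x) = x" for x
    proof -
      define b where "b = (1 / (z - 1)) *\<^sub>C (x - Q x)"
      have b: "Q b = 0" "(z - 1) *\<^sub>C b = x - Q x"
        using z1 by (simp_all add: b_def Qs Q(2) scaleC_scaleC)
      have "R z x = b - S z (Q x)" by (simp add: R_def b_def)
      then have "z *\<^sub>C R z x - B (R z x) = (z - 1) *\<^sub>C b + (A (S z (Q x)) - z *\<^sub>C S z (Q x))"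
        by (simp add: B_def Qs As QS b(1) complex_vector.scale_right_diff_distrib
            complex_vector.scale_left_diff_distrib)
      then show ?thesis by (simp add: b(2) AS[OF z])
    qed
  qed
  have r: "0 < d / 2" "d / 2 < d" using B.rho by auto
  define P where "P = B.riesz (d / 2)"
  have P: "bounded_clinear P" "P (P x) = P x" for x
    unfolding P_def by (rule B.bounded_clinear_circle_mean[OF r continuous_on_id], rule B.riesz_idempotent[OF r])
  have commute: "U (P x) = P (U x)" if "bounded_clinear U" "\<And>x. U (B x) = B (U x)" for U x
    unfolding P_def using that by (rule B.circle_mean_commute[OF r continuous_on_id])
  obtain S' where S': "bounded_clinear S'" "\<And>x. B (S' x) = x - P x" "\<And>x. S' (B x) = x - P x"
    using B.riesz_complement_inverse[OF r] unfolding P_def by blast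
  note V = B.riesz_range_resolvent[OF r, folded P_def]
  note Ps = bounded_clinear_simps[OF P(1)] and S's = bounded_clinear_simps[OF S'(1)]
  have QP: "Q (P x) = P (Q x)" for x
    using Q(1) by (rule commute) (simp add: QB, simp add: B_def Q(2))
  have AP: "A (P x) = P (A x)" for x
    using A by (rule commute) (simp add: B_def As Qs AQ)
  have S'P: "S' (P x) = P (S' x)" for x
    using S'(1) by (rule commute) (simp add: S')
  have PQ: "Q (P x) = P x" for x
  proof -
    \<comment> \<open>On the kernel of \<open>Q\<close> the operator \<open>B - 1\<close> vanishes, whereas it is invertible on the range of \<open>P\<close>.\<close>
    obtain V where V1: "bounded_clinear V" "\<And>x. V (B x - 1 *\<^sub>C x) = P x" using V[of 1] by auto
    define y where "y = P x - Q (P x)"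
    have "Q y = 0" by (simp add: y_def Qs Q(2))
    then have "B y - 1 *\<^sub>C y = 0" by (simp add: B_def As)
    then have "P y = 0" using V1(2)[of y] bounded_clinear_simps(4)[OF V1(1)] by simp
    moreover have "P y = y" by (simp add: y_def Ps P(2) QP)
    ultimately show ?thesis by (simp add: y_def)
  qed
  have BA: "B x = A x" if "Q x = x" for x using that by (simp add: B_def)
  have onto: "\<exists>x. Q x = x \<and> P x = 0 \<and> A x = y" if "Q y = y" "P y = 0" for y
  proof (intro exI[of _ "Q (S' y)"] conjI)
    show "Q (Q (S' y)) = Q (S' y)" by (rule Q)
    show "P (Q (S' y)) = 0" using S'P[of y] that by (simp add: QP[symmetric] S's Qs)
    have "Q (B (S' y)) = y" using that by (simp add: S'(2) Qs Ps)
    then show "A (Q (S' y)) = y" by (simp add: QB)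
  qed
  have inj: "x = 0" if "Q x = x" "P x = 0" "A x = 0" for x
    using S'(3)[of x] that by (simp add: BA S's)
  have "invertible_on (range P) (\<lambda>x. A x - z *\<^sub>C x)" if z: "z \<noteq> 0" for z
  proof -
    obtain V where V1: "bounded_clinear V" "\<And>x. B (V x) - z *\<^sub>C V x = P x" "\<And>x. V (B x - z *\<^sub>C x) = P x"
      using V[OF z] by blast
    note Vs = bounded_clinear_simps[OF V1(1)]
    have VB: "V (B x) = B (V x)" for x
      using V1(2)[of x] V1(3)[of x] by (simp add: Vs diff_eq_eq)
    have VP: "V (P x) = P (V x)" for x
      using V1(1) VB by (rule commute)
    have "V ` range P \<subseteq> range P" using VP by auto
    then have "bounded_clinear_on (range P) V"
      using V1(1) unfolding bounded_clinear_on_def by blast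
    moreover have "V (A x - z *\<^sub>C x) = x \<and> A (V x) - z *\<^sub>C V x = x" if x: "x \<in> range P" for x
    proof -
      have Px: "P x = x" using x P(2) by auto
      have Qx: "Q x = x" using PQ[of x] Px by simp
      have "V x = P (V x)" using VP[of x] Px by simp
      then have QV: "Q (V x) = V x" using PQ[of "V x"] by simp
      show ?thesis using V1(2)[of x] V1(3)[of x] BA[OF Qx] BA[OF QV] Px by simp
    qed
    ultimately show ?thesis unfolding invertible_on_def by blast
  qed
  moreover have "P (Q x) = P x" for x using QP[of x] PQ[of x] by simp
  ultimately show ?thesis using that[of P] P PQ AP onto inj by blast
qed

section \<open>The \<open>g_z\<close>-Kato spectrum is closed and bounded\<close>

text \<open>
  For a small \<open>c\<close> other than \<open>0\<close> the operator \<open>A = T - c\<close> is semi-regular on \<open>M\<close>, and \<open>0\<close> is not an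
  accumulation point of its spectrum on \<open>N\<close>, although another point may be. The projection \<open>P\<close> cuts
  out the part of \<open>N\<close> on which the spectrum of \<open>A\<close> is at most \<open>{0}\<close>; on the rest of \<open>N\<close> the operator
  is invertible, and adding that rest to \<open>M\<close> preserves semi-regularity. The new decomposition is
  given by the kernel and the range of \<open>P\<close>.
\<close>

lemma gz_Kato_small_shift:
  fixes T :: "'a::complex_banach \<Rightarrow> 'a"
  assumes T: "bounded_clinear T" and Kato: "gz_Kato T"
  shows "\<exists>e>0. \<forall>c. cmod c < e \<longrightarrow> gz_Kato (\<lambda>x. T x - c *\<^sub>C x)"
proof -
  obtain M N where "(M, N) \<in> Red T" and reg: "semi_regular_on M T" and zl: "zeroloid_on N T"
    using Kato by (auto simp: gz_Kato_def)
  then have M: "complex_vector.subspace M" "closed M" "T ` M \<subseteq> M"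
    and N: "complex_vector.subspace N" "closed N" "T ` N \<subseteq> N"
    and inter: "M \<inter> N = {0}" and sum: "{x + y | x y. x \<in> M \<and> y \<in> N} = UNIV"
    by (simp_all add: Red_def)
  obtain Q where Q: "bounded_clinear Q" "\<And>x. Q x \<in> N" "\<And>x. x - Q x \<in> M"
      "\<And>x y. x \<in> M \<Longrightarrow> y \<in> N \<Longrightarrow> Q (x + y) = y"
    using bounded_projection_of_direct_sum[OF M(1,2) N(1,2) inter sum] by blast
  have QM: "Q x = 0" if "x \<in> M" for x
    using Q(4)[OF that complex_vector.subspace_0[OF N(1)]] by simp
  have QN: "Q x = x" if "x \<in> N" for x
    using Q(4)[OF complex_vector.subspace_0[OF M(1)] that] by simp
  have rangeQ: "range Q = N" using Q(2) QN by (auto simp: image_iff) (metis QN)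
  note Qs = bounded_clinear_simps[OF Q(1)]
  obtain e where e: "e > 0" "\<And>c. cmod c < e \<Longrightarrow> semi_regular_on M (\<lambda>x. T x - c *\<^sub>C x)"
    using semi_regular_on_small_shift[OF T M reg] by blast
  have "gz_Kato (\<lambda>x. T x - c *\<^sub>C x)" if c: "cmod c < e" "c \<noteq> 0" for c
  proof -
    define A where "A x = T x - c *\<^sub>C x" for x
    have A: "bounded_clinear A" unfolding A_def by (rule bounded_clinear_shift[OF T])
    note As = bounded_clinear_simps[OF A]
    have AM: "A x \<in> M" if "x \<in> M" for x
      unfolding A_def using that M(3)
      by (intro complex_vector.subspace_diff[OF M(1)] complex_vector.subspace_scale[OF M(1)]) auto
    have AN: "A x \<in> N" if "x \<in> N" for x
      unfolding A_def using that N(3)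
      by (intro complex_vector.subspace_diff[OF N(1)] complex_vector.subspace_scale[OF N(1)]) auto
    have AQ: "A (Q x) = Q (A x)" for x
      using Q(4)[OF AM[OF Q(3)[of x]] AN[OF Q(2)[of x]]] by (simp add: As)
    have "\<not> c islimpt spectrum_on N T" using zl c(2) by (auto simp: zeroloid_on_def)
    then obtain \<rho> where rho: "\<rho> > 0" "\<And>w. w \<in> spectrum_on N T \<Longrightarrow> w \<noteq> c \<Longrightarrow> \<not> dist w c < \<rho>"
      by (auto simp: islimpt_approachable)
    have inv: "invertible_on (range Q) (\<lambda>x. A x - z *\<^sub>C x)" if z: "0 < cmod z" "cmod z < \<rho>" for z
    proof -
      have "c + z \<notin> spectrum_on N T" using rho(2)[of "c + z"] z by (auto simp: dist_norm)
      then have "invertible_on N (\<lambda>x. T x - (c + z) *\<^sub>C x)" by (simp add: spectrum_on_def)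
      moreover have "(\<lambda>x. T x - (c + z) *\<^sub>C x) = (\<lambda>x. A x - z *\<^sub>C x)"
        by (simp add: A_def scaleC_add_left fun_eq_iff)
      ultimately show ?thesis by (simp add: rangeQ)
    qed
    obtain P where P: "bounded_clinear P" "\<And>x. P (P x) = P x" "\<And>x. Q (P x) = P x"
        "\<And>x. P (Q x) = P x" "\<And>x. A (P x) = P (A x)"
        "\<And>y. Q y = y \<Longrightarrow> P y = 0 \<Longrightarrow> \<exists>x. Q x = x \<and> P x = 0 \<and> A x = y"
        "\<And>x. Q x = x \<Longrightarrow> P x = 0 \<Longrightarrow> A x = 0 \<Longrightarrow> x = 0"
        "\<And>z. z \<noteq> 0 \<Longrightarrow> invertible_on (range P) (\<lambda>x. A x - z *\<^sub>C x)"
      by (rule isolated_point_projection[OF A Q(1) QN[OF Q(2)] AQ rho(1) inv])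
        (assumption, assumption, rule that, assumption, blast+)
    note Ps = bounded_clinear_simps[OF P(1)]
    define M' where "M' = {x. P x = 0}"
    have M'M: "M \<subseteq> M'"
    proof
      fix x assume "x \<in> M"
      then show "x \<in> M'" using P(4)[of x] by (simp add: M'_def QM Ps)
    qed
    have cont: "continuous_on UNIV P" "continuous_on UNIV Q"
      using Ps(6) Qs(6) by (auto intro: linear_continuous_on)
    have rangeP: "range P = {x. P x = x}" using P(2) by (auto simp: image_iff) (metis)
    have AM': "A ` M' \<subseteq> M'" using P(5) by (auto simp: M'_def As) (metis As(4))
    have "(M', range P) \<in> Red A"
    proof -
      have "complex_vector.subspace M'" "complex_vector.subspace (range P)"
        unfolding rangeP by (auto simp: M'_def complex_vector.subspace_def Ps)
      moreover have "closed M'" "closed (range P)"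
        unfolding rangeP M'_def using cont by (auto intro!: closed_Collect_eq continuous_intros)
      moreover have "A ` range P \<subseteq> range P" using P(5) by auto
      moreover have "M' \<inter> range P = {0}" unfolding rangeP by (auto simp: M'_def Ps)
      moreover have "x \<in> {x + y | x y. x \<in> M' \<and> y \<in> range P}" for x
      proof -
        have "x = (x - P x) + P x" "x - P x \<in> M'" "P x \<in> range P" by (auto simp: M'_def Ps P(2))
        then show ?thesis by blast
      qed
      ultimately show ?thesis using AM' unfolding Red_def by blast
    qed
    moreover have "semi_regular_on M' A"
    proof -
      have reg_A: "closed (A ` M)" "\<And>x n. x \<in> M \<Longrightarrow> A x = 0 \<Longrightarrow> x \<in> (A ^^ n) ` M"
        using e(2)[OF c(1)] AM semi_regular_on_iff[of A M] by (auto simp: A_def[abs_def])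
      \<comment> \<open>As \<open>A\<close> is onto on the part of \<open>M'\<close> inside \<open>N\<close>, membership in the range is only a condition on the
        component along \<open>M\<close>, where the range is closed.\<close>
      have "A ` M' = {v. P v = 0} \<inter> (\<lambda>v. v - Q v) -` (A ` M)"
      proof (intro equalityI subsetI)
        fix v assume "v \<in> A ` M'"
        then obtain x where x: "v = A x" "P x = 0" by (auto simp: M'_def)
        have "v - Q v = A (x - Q x)" by (simp add: x As AQ)
        moreover have "P v = 0" using P(5)[of x] x by (simp add: As)
        ultimately show "v \<in> {v. P v = 0} \<inter> (\<lambda>v. v - Q v) -` (A ` M)" using Q(3) by blast
      next
        fix v assume v: "v \<in> {v. P v = 0} \<inter> (\<lambda>v. v - Q v) -` (A ` M)"
        then obtain m where m: "m \<in> M" "v - Q v = A m" by auto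
        have "P (Q v) = 0" using v P(4) by simp
        then obtain x where x: "Q x = x" "P x = 0" "A x = Q v" using P(6)[OF QN[OF Q(2)]] by blast
        have "v = A (m + x)" using m x by (simp add: As flip: m(2))
        moreover have "m + x \<in> M'" using m(1) M'M x by (auto simp: M'_def Ps)
        ultimately show "v \<in> A ` M'" by blast
      qed
      moreover have "closed ({v. P v = 0} \<inter> (\<lambda>v. v - Q v) -` (A ` M))"
        using cont reg_A(1)
        by (intro closed_Int closed_Collect_eq continuous_closed_vimage continuous_intros)
          (auto simp: continuous_on_eq_continuous_at)
      ultimately have "closed (A ` M')" by simp
      moreover have "x \<in> (A ^^ n) ` M'" if "x \<in> M'" "A x = 0" for x n
      proof -
        have "Q x = 0"
        proof (rule P(7))
          show "Q (Q x) = Q x" by (rule QN[OF Q(2)])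
          show "P (Q x) = 0" using that P(4)[of x] by (simp add: M'_def)
          show "A (Q x) = 0" using that AQ[of x] by (simp add: Qs)
        qed
        then have "x \<in> M" using Q(3)[of x] by simp
        then show ?thesis using reg_A(2) that(2) M'M by blast
      qed
      ultimately show ?thesis using semi_regular_on_iff[OF AM'] by blast
    qed
    moreover have "zeroloid_on (range P) A"
    proof -
      have "spectrum_on (range P) A \<subseteq> {0}" using P(8) by (auto simp: spectrum_on_def)
      then have "finite (spectrum_on (range P) A)" by (rule finite_subset) simp
      then show ?thesis by (auto simp: zeroloid_on_def islimpt_finite)
    qed
    ultimately show ?thesis unfolding gz_Kato_def A_def[abs_def, symmetric] by blast
  qed
  moreover have "gz_Kato (\<lambda>x. T x - c *\<^sub>C x)" if "c = 0" for c
    using Kato that by simp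
  ultimately show ?thesis using e(1) by blast
qed

text \<open>
  Beyond twice a norm bound of \<open>T\<close> the operator \<open>T - c\<close> is bijective, hence semi-regular on the whole
  space, and the zeroloid summand can be \<open>{0}\<close>.
\<close>

lemma gz_Kato_large_shift:
  fixes T :: "'a::complex_banach \<Rightarrow> 'a"
  assumes T: "bounded_clinear T"
  shows "\<exists>K. \<forall>c. K < cmod c \<longrightarrow> gz_Kato (\<lambda>x. T x - c *\<^sub>C x)"
proof -
  note Ts = bounded_clinear_simps[OF T]
  obtain K where K: "0 < K" "\<And>x. norm (T x) \<le> norm x * K"
    using bounded_linear.pos_bounded[OF Ts(6)] by blast
  have "gz_Kato (\<lambda>x. T x - c *\<^sub>C x)" if c: "2 * K < cmod c" for c
  proof -
    define S where "S x = T x - c *\<^sub>C x" for x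
    have S: "bounded_clinear S" unfolding S_def by (rule bounded_clinear_shift[OF T])
    note Ss = bounded_clinear_simps[OF S]
    have c0: "c \<noteq> 0" "0 < cmod c" using c K(1) by auto
    have "\<exists>x\<in>UNIV. norm x \<le> 2 * (1 / cmod c) * norm y \<and> S x = y" for y
    proof (rule exact_preimage_of_approximate_preimages[OF Ss(6) subspace_UNIV closed_UNIV, where Y = UNIV])
      fix y :: 'a
      \<comment> \<open>The leading term of the Neumann series; the error is \<open>- T x\<close>.\<close>
      define x where "x = (- 1 / c) *\<^sub>C y"
      have nx: "norm x = norm y / cmod c" by (simp add: x_def norm_scaleC norm_divide)
      have "y - S x = - T x" using c0 by (simp add: S_def x_def scaleC_scaleC)
      then have "norm (y - S x) \<le> norm y / cmod c * K" using K(2)[of x] nx by simp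
      also have "\<dots> = norm y * (K / cmod c)" by simp
      also have "\<dots> \<le> norm y * (1 / 2)"
        using c c0 by (intro mult_left_mono) (auto simp: field_simps)
      finally show "\<exists>x\<in>UNIV. norm x \<le> 1 / cmod c * norm y \<and> y - S x \<in> UNIV \<and> norm (y - S x) \<le> norm y / 2"
        using nx by (intro bexI[of _ x]) auto
    qed auto
    then have onto: "range S = UNIV" by (metis surj_def)
    have inj: "x = 0" if "S x = 0" for x
    proof -
      have "cmod c * norm x \<le> K * norm x"
        using K(2)[of x] that by (simp add: S_def norm_scaleC mult.commute)
      then have "norm x \<le> 0" using c K(1) by (simp add: mult_le_cancel_right)
      then show ?thesis by simp
    qed
    have S0: "(S ^^ n) 0 = 0" for n by (induction n) (simp_all add: Ss)
    have "semi_regular_on UNIV S"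
      using inj by (subst semi_regular_on_iff) (auto simp: onto image_iff intro!: exI[of _ 0] simp: S0)
    moreover have "(UNIV, {0}) \<in> Red S"
      by (auto simp: Red_def Ss complex_vector.subspace_UNIV complex_vector.subspace_single_0)
    moreover have "zeroloid_on {0} S"
    proof -
      have "bounded_clinear_on {0::'a} (\<lambda>x. x)" by (auto simp: bounded_clinear_on_def intro: exI[of _ 1])
      then have "invertible_on {0} (\<lambda>x. S x - z *\<^sub>C x)" for z
        unfolding invertible_on_def by (intro exI[of _ "\<lambda>x. x"]) (simp add: Ss)
      then show ?thesis by (simp add: zeroloid_on_def spectrum_on_def islimpt_finite)
    qed
    ultimately show ?thesis unfolding gz_Kato_def S_def[abs_def, symmetric] by blast
  qed
  then show ?thesis by blast
qed

theorem corollary2p9: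
  fixes T :: "'a::complex_banach \<Rightarrow> 'a"
  assumes "\<not> (\<exists>B::'a set. finite B \<and> complex_vector.span B = UNIV)"
    and "bounded_clinear T"
  shows "compact (gz_Kato_spectrum T)"
proof -
  note T = \<open>bounded_clinear T\<close>
  have "open (- gz_Kato_spectrum T)"
    unfolding open_dist
  proof
    fix c assume "c \<in> - gz_Kato_spectrum T"
    then have "gz_Kato (\<lambda>x. T x - c *\<^sub>C x)" by (simp add: gz_Kato_spectrum_def)
    from gz_Kato_small_shift[OF bounded_clinear_shift[OF T] this]
    obtain e where e: "e > 0"
      "\<And>z. cmod z < e \<Longrightarrow> gz_Kato (\<lambda>x. (T x - c *\<^sub>C x) - z *\<^sub>C x)" by blast
    have "w \<in> - gz_Kato_spectrum T" if "dist w c < e" for w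
    proof -
      have "gz_Kato (\<lambda>x. (T x - c *\<^sub>C x) - (w - c) *\<^sub>C x)"
        using that by (intro e(2)) (simp add: dist_norm)
      also have "(\<lambda>x. (T x - c *\<^sub>C x) - (w - c) *\<^sub>C x) = (\<lambda>x. T x - w *\<^sub>C x)"
        by (simp add: complex_vector.scale_left_diff_distrib)
      finally show ?thesis by (simp add: gz_Kato_spectrum_def)
    qed
    then show "\<exists>e>0. \<forall>w. dist w c < e \<longrightarrow> w \<in> - gz_Kato_spectrum T" using e(1) by blast
  qed
  then have "closed (gz_Kato_spectrum T)" by (simp add: closed_def)
  moreover obtain K where "\<And>c. K < cmod c \<Longrightarrow> gz_Kato (\<lambda>x. T x - c *\<^sub>C x)"
    using gz_Kato_large_shift[OF T] by blast
  then have "bounded (gz_Kato_spectrum T)"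
    unfolding bounded_iff gz_Kato_spectrum_def by (intro exI[of _ K]) (auto simp: not_less[symmetric])
  ultimately show ?thesis by (simp add: compact_eq_bounded_closed)
qed

end
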